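(* Let $m\ge 1$ and $n > m+3$ be integers, $\sigma>0$, $\theta^\ast\in\mathbb{R}^m$, and $\Sigma_\phi\in\mathbb{R}^{m\times m}$ symmetric positive definite. Let $\phi_1,\dots,\phi_n,\hat\phi$ be i.i.d. $\mathcal{N}(0,\Sigma_\phi)$ random vectors in $\mathbb{R}^m$ (the feature vectors $\phi(x_i)$ of the training inputs and $\phi(\hat x)$ of a new input), and let $z_1,\dots,z_n,\hat z$ be i.i.d. $\mathcal{N}(0,1)$, independent of the features. Set $y_i = \phi_i^T\theta^\ast + \sigma z_i$, $\hat y = \hat\phi^T\theta^\ast + \sigma\hat z$, let $\Phi\in\mathbb{R}^{n\times m}$ be the matrix with rows $\phi_i^T$ (almost surely of full column rank), $y=(y_1,\dots,y_n)^T$, and $\theta^{LS} = (\Phi^T\Phi)^{-1}\Phi^T y$. Let $\ell = (\hat y - \hat\phi^T\theta^{LS})^2$. Then for every $\delta\in(0,1)$, with probability at least $1-\delta$, $$\ell \le \frac{\sigma^2}{n-m-1}\left[m + \frac{1}{\sqrt{\delta}}\sqrt{\frac{m^3 - m^2(n-3) - 3m(n-3)(n-1) + 3(n-3)(n-1)^2}{n-m-3}}\right].$$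
   Context: All probabilities and expectations are taken jointly over the training features, training noise, the new feature vector and the new noise. *)

theory Defs
  imports "HOL-Analysis.Analysis" "HOL-Probability.Probability"
begin

definition sym_pos_def_mat :: "real^'m^'m \<Rightarrow> bool" where
  "sym_pos_def_mat S \<longleftrightarrow> transpose S = S \<and> (\<forall>x. x \<noteq> 0 \<longrightarrow> x \<bullet> (S *v x) > 0)"

definition mvn_density :: "real^'m^'m \<Rightarrow> real^'m \<Rightarrow> real" where
  "mvn_density S x =
     exp (- (x \<bullet> (matrix_inv S *v x)) / 2) / sqrt ((2 * pi) ^ CARD('m) * det S)"

definition gaussian_vec :: "real^'m^'m \<Rightarrow> (real^'m) measure" where
  "gaussian_vec S = density lborel (\<lambda>x. ennreal (mvn_density S x))"

definition std_normal :: "real measure" where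
  "std_normal = density lborel (\<lambda>x. ennreal (std_normal_density x))"

text \<open>Canonical joint sample space: features phi_0..phi_n and noises z_0..z_n, all independent;
  indices 0..n-1 are the training data, index n is the new input.\<close>
definition sample_space :: "nat \<Rightarrow> real^'m^'m \<Rightarrow>
    ((nat \<Rightarrow> real^'m) \<times> (nat \<Rightarrow> real)) measure" where
  "sample_space n S = (PiM {..n} (\<lambda>_. gaussian_vec S)) \<Otimes>\<^sub>M (PiM {..n} (\<lambda>_. std_normal))"

definition outer :: "real^'m \<Rightarrow> real^'m^'m" where
  "outer v = (\<chi> j k. v $ j * v $ k)"

text \<open>Least-squares estimate (Phi^T Phi)^{-1} Phi^T y, with Phi^T Phi = sum_i phi_i phi_i^T and
  Phi^T y = sum_i y_i phi_i.\<close>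
definition theta_LS :: "nat \<Rightarrow> (nat \<Rightarrow> real^'m) \<Rightarrow> (nat \<Rightarrow> real) \<Rightarrow> real^'m" where
  "theta_LS n phi y = matrix_inv (\<Sum>i<n. outer (phi i)) *v (\<Sum>i<n. y i *\<^sub>R phi i)"

end

theory Submission
  imports Defs "HOL-Real_Asymp.Real_Asymp"
begin

text \<open>
  Write \<open>W = \<Phi>\<^sup>T \<Phi>\<close> and let \<open>q = v \<bullet> W\<^sup>-\<^sup>1 v\<close> with \<open>v\<close> the new feature vector. Given the features, the
  prediction error is \<open>\<sigma>\<close> times a centred Gaussian of variance \<open>1 + q\<close>. For fixed \<open>v\<close>, normalised to
  \<open>b\<close> in the \<open>S\<^sup>-\<^sup>1\<close> inner product, the components \<open>x\<close> of the training features along \<open>b\<close> may be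
  resampled independently, and \<open>1 / (b \<bullet> W\<^sup>-\<^sup>1 b)\<close> is then the residual sum of squares \<open>D\<close> of the
  regression of \<open>x\<close> on the remaining components. The Laplace transform \<open>E exp (-t D) =
  (1 + 2 t) powr (-(n - m + 1) / 2)\<close> yields \<open>E (1 / D)\<close> and \<open>E (1 / D\<^sup>2)\<close> by integration over \<open>t\<close>,
  hence the first two moments of the scaled loss \<open>X = \<ell> / \<sigma>\<^sup>2\<close>:
  \<open>E X = 1 + m / (n - m - 1)\<close> and \<open>E X\<^sup>2 = 3 (n - 1) (n - 3) / ((n - m - 1) (n - m - 3))\<close>.
  With \<open>c = m / (n - m - 1)\<close>, the claimed bound is \<open>c + sqrt ((E X\<^sup>2 - c\<^sup>2) / \<delta>)\<close>. As \<open>c\<close> is not the mean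
  but lies below it, \<open>E (X - c)\<^sup>2 \<le> E X\<^sup>2 - c\<^sup>2\<close>, and Chebyshev's inequality about \<open>c\<close> suffices.
\<close>

section \<open>Measurability of matrix operations\<close>

text \<open>All moments are computed as nonnegative integrals: Tonelli then applies without
  integrability checks, and finiteness is read off from the values. The obstacle is the law of an
  inverse Gram quadratic form. Given the components other than \<open>x\<close>, \<open>D\<close> is
  chi-squared with n - m + 1 degrees of freedom, but an argument through projections calls for
  orthogonal coordinates that depend on the sample. The Laplace transform alone is enough, and it
  does not depend on the fixed components, so averaging over them changes nothing. The degrees of
  freedom explain n > m + 3: it says n - m + 1 > 4, which makes E (1 / D^2) finite. Averaging over
  the new vector \<open>v\<close> brings in Q = v . S^-1 v, chi-squared with m degrees of freedom,
  so E Q = m and E Q^2 = m (m + 2). Hence E q = m / (n - m - 1) and E q^2 = m (m + 2) / ((n - m - 1)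
  (n - m - 3)). Given the features, X is 1 + q times the square of a standard normal, whence E X = E
  (1 + q) and E X^2 = 3 E (1 + q)^2.\<close>

lemma borel_measurable_vecI:
  fixes f :: "'a \<Rightarrow> 'b::euclidean_space^'n"
  assumes "\<And>i. (\<lambda>x. f x $ i) \<in> borel_measurable M"
  shows "f \<in> borel_measurable M"
  unfolding borel_measurable_euclidean_space[of f]
proof
  fix b :: "'b^'n" assume "b \<in> Basis"
  then obtain i u where b: "b = axis i u" by (auto simp: Basis_vec_def)
  show "(\<lambda>x. f x \<bullet> b) \<in> borel_measurable M"
    using assms[of i] by (simp add: b inner_axis)
qed

lemma borel_measurable_vec_nth [measurable (raw)]:
  fixes f :: "'a \<Rightarrow> 'b::euclidean_space^'n"
  assumes "f \<in> borel_measurable M"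
  shows "(\<lambda>x. f x $ i) \<in> borel_measurable M"
  using assms
  by (rule borel_measurable_continuous_on[of "\<lambda>v. v $ i", rotated]) (intro continuous_intros)

lemma borel_measurable_det [measurable (raw)]:
  fixes A :: "'a \<Rightarrow> real^'n^'n"
  assumes [measurable]: "A \<in> borel_measurable M"
  shows "(\<lambda>x. det (A x)) \<in> borel_measurable M"
  unfolding det_def by measurable

lemma borel_measurable_matrix_vector_mult [measurable (raw)]:
  fixes A :: "'a \<Rightarrow> real^'n^'m"
  assumes [measurable]: "A \<in> borel_measurable M" "f \<in> borel_measurable M"
  shows "(\<lambda>x. A x *v f x) \<in> borel_measurable M"
  by (rule borel_measurable_vecI) (simp add: matrix_vector_mult_def)

lemma borel_measurable_outer [measurable (raw)]:
  assumes [measurable]: "f \<in> borel_measurable M"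
  shows "(\<lambda>x. outer (f x)) \<in> borel_measurable M"
  by (intro borel_measurable_vecI) (simp add: outer_def)

lemma
  fixes A :: "'a::semiring_1^'n^'m"
  assumes "invertible A"
  shows matrix_inv_right: "A ** matrix_inv A = mat 1"
    and matrix_inv_left: "matrix_inv A ** A = mat 1"
  using someI_ex[OF assms[unfolded invertible_def]] by (simp_all add: matrix_inv_def)

lemma matrix_inv_mult_vec:
  fixes A :: "real^'n^'n"
  assumes "invertible A"
  shows "matrix_inv A *v (A *v x) = x" "A *v (matrix_inv A *v x) = x"
  by (simp_all add: matrix_vector_mul_assoc matrix_inv_left matrix_inv_right assms)

lemma matrix_inv_eqI:
  fixes A :: "real^'n^'n"
  assumes "A ** B = mat 1"
  shows "matrix_inv A = B"
proof -
  have "invertible A" using assms invertible_right_inverse by blast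
  then have "matrix_inv A = matrix_inv A ** (A ** B)" by (simp add: assms)
  also have "\<dots> = B" using \<open>invertible A\<close> by (simp add: matrix_mul_assoc matrix_inv_left)
  finally show ?thesis .
qed

text \<open>For singular matrices the defining \<open>SOME\<close> ranges over the empty predicate, so
  \<^const>\<open>matrix_inv\<close> is constant there.\<close>
lemma borel_measurable_matrix_inv [measurable (raw)]:
  fixes A :: "'a \<Rightarrow> real^'n^'n"
  assumes [measurable]: "A \<in> borel_measurable M"
  shows "(\<lambda>x. matrix_inv (A x)) \<in> borel_measurable M"
proof -
  define Z :: "real^'n^'n" where "Z = (SOME _. False)"
  \<comment> \<open>Off the singular set column \<open>l\<close> of the inverse solves a linear
    system with a unit vector on the right, so Cramer's rule gives its entries as quotients of
    determinants, which are measurable.\<close>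
  have *: "matrix_inv (A x) = (if det (A x) = 0 then Z else
      (\<chi> k l. det (\<chi> i j. if j = k then axis l 1 $ i else A x $ i $ j) / det (A x)))" for x
  proof (cases "det (A x) = 0")
    case True
    then have "\<not> invertible (A x)" by (simp add: invertible_det_nz)
    then have "(\<lambda>B. A x ** B = mat 1 \<and> B ** A x = mat 1) = (\<lambda>_. False)"
      by (auto simp: invertible_def)
    then show ?thesis using True by (simp add: matrix_inv_def Z_def)
  next
    case False
    then have inv: "invertible (A x)" by (simp add: invertible_det_nz)
    have "matrix_inv (A x) $ k $ l = det (\<chi> i j. if j = k then axis l 1 $ i else A x $ i $ j) / det (A x)" for k l
    proof -
      have "A x *v (matrix_inv (A x) *v axis l 1) = axis l 1"
        using inv by (simp add: matrix_inv_mult_vec)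
      then have "matrix_inv (A x) *v axis l 1 =
          (\<chi> k. det (\<chi> i j. if j = k then axis l 1 $ i else A x $ i $ j) / det (A x))"
        using cramer[OF False] by blast
      then show ?thesis
        by (simp add: vec_eq_iff matrix_vector_mult_basis column_def)
    qed
    then show ?thesis using False by (simp add: vec_eq_iff)
  qed
  have [measurable]: "(\<lambda>x. \<chi> i j. if j = k then axis l 1 $ i else A x $ i $ j) \<in> borel_measurable M" for k l
    by (intro borel_measurable_vecI) simp
  have [measurable]: "(\<lambda>x. \<chi> k l. det (\<chi> i j. if j = k then axis l 1 $ i else A x $ i $ j) / det (A x))
      \<in> borel_measurable M"
    by (intro borel_measurable_vecI) simp
  show ?thesis unfolding * by measurable
qed

section \<open>Linear change of variables\<close>

lemma measurable_vec_lambda_PiM [measurable]: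
  "vec_lambda \<in> PiM (UNIV :: 'n::finite set) (\<lambda>_. borel :: real measure) \<rightarrow>\<^sub>M borel"
  by (rule borel_measurable_vecI) simp

text \<open>Both measures give a box the product of its side lengths, which determines Lebesgue
  measure. This opens the way to integrating coordinate by coordinate.\<close>

lemma lborel_vec_eq_distr_PiM:
  "(lborel :: (real^'n) measure) = distr (PiM UNIV (\<lambda>_. lborel)) borel vec_lambda"
proof (rule lborel_eqI)
  fix l u :: "real^'n" assume le: "\<And>b. b \<in> Basis \<Longrightarrow> l \<bullet> b \<le> u \<bullet> b"
  have le': "l $ i \<le> u $ i" for i
    using le[of "axis i 1"] by (simp add: inner_axis axis_in_Basis_iff)
  have B: "(Basis :: (real^'n) set) = range (\<lambda>i. axis i 1)"
    by (auto simp: Basis_vec_def)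
  have inj: "inj (\<lambda>i::'n. axis i (1::real))" by (auto simp: inj_on_def axis_eq_axis)
  interpret product_sigma_finite "\<lambda>_::'n. lborel :: real measure" ..
  have [measurable]: "(vec_lambda :: ('n \<Rightarrow> real) \<Rightarrow> _) \<in> PiM UNIV (\<lambda>_. lborel) \<rightarrow>\<^sub>M borel"
    using measurable_vec_lambda_PiM by (simp cong: measurable_cong_sets sets_PiM_cong)
  have "emeasure (distr (PiM UNIV (\<lambda>_. lborel)) borel vec_lambda) (box l u) =
      emeasure (PiM UNIV (\<lambda>_. lborel)) (PiE UNIV (\<lambda>i. {l $ i <..< u $ i}))"
    by (subst emeasure_distr) (auto intro!: arg_cong2[where f=emeasure]
       simp: space_PiM mem_box_cart PiE_iff)
  also have "\<dots> = (\<Prod>i\<in>UNIV. ennreal (u $ i - l $ i))"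
    by (subst emeasure_PiM) (auto simp: le')
  also have "\<dots> = (\<Prod>b\<in>Basis. (u - l) \<bullet> b)"
    unfolding B prod.reindex[OF inj] by (simp add: prod_ennreal le' inner_axis)
  finally show "emeasure (distr (PiM UNIV (\<lambda>_. lborel)) borel vec_lambda) (box l u) =
      (\<Prod>b\<in>Basis. (u - l) \<bullet> b)" .
qed simp


lemma nn_integral_lborel_vec:
  fixes F :: "real^'n \<Rightarrow> ennreal"
  assumes [measurable]: "F \<in> borel_measurable borel"
  shows "(\<integral>\<^sup>+x. F x \<partial>lborel) = (\<integral>\<^sup>+f. F (vec_lambda f) \<partial>PiM UNIV (\<lambda>_. lborel))"
proof -
  have [measurable]: "(vec_lambda :: ('n \<Rightarrow> real) \<Rightarrow> _) \<in> PiM UNIV (\<lambda>_. lborel) \<rightarrow>\<^sub>M borel"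
    using measurable_vec_lambda_PiM by (simp cong: measurable_cong_sets sets_PiM_cong)
  show ?thesis
    by (subst lborel_vec_eq_distr_PiM, subst nn_integral_distr) auto
qed

text \<open>With coordinate \<open>m\<close> integrated innermost, the shear is a translation by
  \<open>c * f n\<close>, a constant for that integral because \<open>m \<noteq> n\<close>.\<close>

lemma nn_integral_lborel_shear:
  fixes F :: "real^'n \<Rightarrow> ennreal"
  assumes [measurable]: "F \<in> borel_measurable borel" and "m \<noteq> n"
  shows "(\<integral>\<^sup>+x. F (\<chi> i. if i = m then x $ m + c * x $ n else x $ i) \<partial>lborel) = (\<integral>\<^sup>+x. F x \<partial>lborel)"
proof -
  interpret product_sigma_finite "\<lambda>_::'n. lborel :: real measure" ..
  define I where "I = UNIV - {m}"
  have U: "UNIV = insert m I" "finite I" "m \<notin> I" by (auto simp: I_def)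
  have [measurable]: "vec_lambda \<in> PiM (insert m I) (\<lambda>_. lborel :: real measure) \<rightarrow>\<^sub>M borel"
    using measurable_vec_lambda_PiM[where 'n='n] unfolding U(1)[symmetric]
    by (simp cong: measurable_cong_sets sets_PiM_cong)
  let ?T = "\<lambda>x :: real^'n. \<chi> i. if i = m then x $ m + c * x $ n else x $ i"
  have [measurable]: "?T \<in> borel_measurable borel"
    by (rule borel_measurable_vecI) auto
  have T: "?T (vec_lambda (f(m := y))) = vec_lambda (f(m := c * f n + 1 * y))" for f y
    using \<open>m \<noteq> n\<close> by (auto simp: vec_eq_iff)
  have "(\<integral>\<^sup>+x. F (?T x) \<partial>lborel) = (\<integral>\<^sup>+f. F (?T (vec_lambda f)) \<partial>PiM UNIV (\<lambda>_. lborel))"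
    by (rule nn_integral_lborel_vec) measurable
  also have "\<dots> = (\<integral>\<^sup>+f. (\<integral>\<^sup>+y. F (vec_lambda (f(m := c * f n + 1 * y))) \<partial>lborel) \<partial>PiM I (\<lambda>_. lborel))"
    unfolding U(1) by (subst product_nn_integral_insert) (use U in \<open>auto simp only: T\<close>, measurable)
  also have "\<dots> = (\<integral>\<^sup>+f. (\<integral>\<^sup>+y. F (vec_lambda (f(m := y))) \<partial>lborel) \<partial>PiM I (\<lambda>_. lborel))"
  proof (rule nn_integral_cong)
    fix f assume f: "f \<in> space (PiM I (\<lambda>_. lborel :: real measure))"
    have [measurable]: "(\<lambda>y::real. vec_lambda (f(m := y))) \<in> borel_measurable borel"
      by (rule borel_measurable_vecI) auto
    show "(\<integral>\<^sup>+y. F (vec_lambda (f(m := c * f n + 1 * y))) \<partial>lborel) = (\<integral>\<^sup>+y. F (vec_lambda (f(m := y))) \<partial>lborel)"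
      using nn_integral_real_affine[of "\<lambda>y. F (vec_lambda (f(m := y)))" 1 "c * f n"] by simp
  qed
  also have "\<dots> = (\<integral>\<^sup>+f. F (vec_lambda f) \<partial>PiM UNIV (\<lambda>_. lborel))"
    unfolding U(1) by (subst product_nn_integral_insert) (use U in auto)
  also have "\<dots> = (\<integral>\<^sup>+x. F x \<partial>lborel)"
    by (rule nn_integral_lborel_vec[symmetric]) measurable
  finally show ?thesis .
qed

lemma nn_integral_lborel_diagonal:
  fixes F :: "real^'n \<Rightarrow> ennreal"
  assumes [measurable]: "F \<in> borel_measurable borel" and "\<And>i. d i \<noteq> 0"
  shows "(\<integral>\<^sup>+x. F x \<partial>lborel) = ennreal \<bar>\<Prod>i\<in>UNIV. d i\<bar> * (\<integral>\<^sup>+x. F (\<chi> i. d i * x $ i) \<partial>lborel)"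
proof -
  \<comment> \<open>The library scaling theorem indexes factors by basis vectors; \<open>c\<close>
    is \<open>d\<close> carried over along the bijection from indices to unit vectors.\<close>
  define c where "c b = d (THE i. b = axis i 1)" for b :: "real^'n"
  have c: "c (axis i 1) = d i" for i
    by (simp add: c_def axis_eq_axis)
  have B: "(Basis :: (real^'n) set) = range (\<lambda>i. axis i 1)"
    by (auto simp: Basis_vec_def)
  have inj: "inj (\<lambda>i::'n. axis i (1::real))" by (auto simp: inj_on_def axis_eq_axis)
  have T: "0 + (\<Sum>j\<in>Basis. (c j * (x \<bullet> j)) *\<^sub>R j) = (\<chi> i. d i * x $ i)" for x
    unfolding B sum.reindex[OF inj]
    by (simp add: c inner_axis vec_eq_iff) (simp add: axis_def if_distrib sum.delta cong: if_cong)
  have P: "(\<Prod>j\<in>Basis. \<bar>c j\<bar>) = \<bar>\<Prod>i\<in>UNIV. d i\<bar>"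
    unfolding B prod.reindex[OF inj] by (simp add: c abs_prod)
  have [measurable]: "(\<lambda>x::real^'n. \<chi> i. d i * x $ i) \<in> borel_measurable borel"
    by (rule borel_measurable_vecI) auto
  have eq: "lborel = density (distr lborel borel (\<lambda>x. \<chi> i. d i * x $ i)) (\<lambda>_. ennreal \<bar>\<Prod>i\<in>UNIV. d i\<bar>)"
  proof -
    have "c j \<noteq> 0" if "j \<in> Basis" for j using that assms(2) by (auto simp: B c)
    from lborel_affine_euclidean[of c "0 :: real^'n", OF this] show ?thesis unfolding T P .
  qed
  have "integral\<^sup>N lborel F =
      integral\<^sup>N (density (distr lborel borel (\<lambda>x. \<chi> i. d i * x $ i)) (\<lambda>_. ennreal \<bar>\<Prod>i\<in>UNIV. d i\<bar>)) F"
    by (rule arg_cong[where f="\<lambda>M. integral\<^sup>N M F", OF eq])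
  then show ?thesis
    by (simp add: nn_integral_density nn_integral_distr nn_integral_cmult)
qed

text \<open>Swapping two coordinates maps boxes to boxes and only permutes the side lengths, so
  volume is preserved.\<close>

lemma nn_integral_lborel_transpose:
  fixes F :: "real^'n \<Rightarrow> ennreal"
  assumes [measurable]: "F \<in> borel_measurable borel"
  shows "(\<integral>\<^sup>+x. F (\<chi> i. x $ Transposition.transpose m n i) \<partial>lborel) = (\<integral>\<^sup>+x. F x \<partial>lborel)"
proof -
  let ?\<tau> = "Transposition.transpose m n"
  let ?T = "\<lambda>x::real^'n. \<chi> i. x $ ?\<tau> i"
  have [measurable]: "?T \<in> borel_measurable borel"
    by (rule borel_measurable_vecI) auto
  have bij: "bij ?\<tau>" by simp
  have B: "(Basis :: (real^'n) set) = range (\<lambda>i. axis i 1)"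
    by (auto simp: Basis_vec_def)
  have inj: "inj (\<lambda>i::'n. axis i (1::real))" by (auto simp: inj_on_def axis_eq_axis)
  have eq: "lborel = distr lborel borel ?T"
  proof (rule lborel_eqI)
    fix l u :: "real^'n" assume le: "\<And>b. b \<in> Basis \<Longrightarrow> l \<bullet> b \<le> u \<bullet> b"
    have le': "l $ i \<le> u $ i" for i
      using le[of "axis i 1"] by (simp add: inner_axis axis_in_Basis_iff)
    have pre: "?T -` box l u = box (?T l) (?T u)"
    proof (intro set_eqI iffI)
      fix x assume "x \<in> ?T -` box l u"
      then have "l $ i < x $ ?\<tau> i \<and> x $ ?\<tau> i < u $ i" for i by (simp add: mem_box_cart)
      from this[of "?\<tau> i" for i] show "x \<in> box (?T l) (?T u)" by (simp add: mem_box_cart)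
    next
      fix x assume "x \<in> box (?T l) (?T u)"
      then have "l $ ?\<tau> i < x $ i \<and> x $ i < u $ ?\<tau> i" for i by (simp add: mem_box_cart)
      from this[of "?\<tau> i" for i] show "x \<in> ?T -` box l u" by (simp add: mem_box_cart)
    qed
    have "emeasure (distr lborel borel ?T) (box l u) = emeasure lborel (box (?T l) (?T u))"
      by (simp add: emeasure_distr pre)
    also have "\<dots> = ennreal (\<Prod>b\<in>Basis. (?T u - ?T l) \<bullet> b)"
      by (rule emeasure_lborel_box) (auto simp: B inner_axis le')
    also have "(\<Prod>b\<in>Basis. (?T u - ?T l) \<bullet> b) = (\<Prod>i\<in>UNIV. (u - l) $ ?\<tau> i)"
      unfolding B prod.reindex[OF inj] by (simp add: inner_axis)
    also have "\<dots> = (\<Prod>i\<in>UNIV. (u - l) $ i)"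
      using prod.reindex_bij_betw[OF bij, of "\<lambda>i. (u - l) $ i"] by simp
    also have "\<dots> = (\<Prod>b\<in>Basis. (u - l) \<bullet> b)"
      unfolding B prod.reindex[OF inj] by (simp add: inner_axis)
    finally show "emeasure (distr lborel borel ?T) (box l u) = ennreal (\<Prod>b\<in>Basis. (u - l) \<bullet> b)" .
  qed simp
  have "integral\<^sup>N lborel F = integral\<^sup>N (distr lborel borel ?T) F"
    by (rule arg_cong[where f="\<lambda>M. integral\<^sup>N M F", OF eq])
  then show ?thesis by (simp add: nn_integral_distr)
qed

text \<open>The change-of-variables theorems of HOL-Analysis assume a well-ordered index type; by
  reduction to elementary matrices the linear case holds for any finite index type.\<close>
lemma nn_integral_lborel_linear:
  fixes A :: "real^'n^'n" and F :: "real^'n \<Rightarrow> ennreal"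
  assumes "det A \<noteq> 0" and "F \<in> borel_measurable borel"
  shows "(\<integral>\<^sup>+x. F x \<partial>lborel) = ennreal \<bar>det A\<bar> * (\<integral>\<^sup>+x. F (A *v x) \<partial>lborel)"
proof -
  \<comment> \<open>The guard \<open>det A \<noteq> 0\<close> makes the zero-row generators vacuous
    and passes to both factors of a product. Quantifying over \<open>F\<close> lets the product case
    apply the hypothesis for \<open>B\<close> to \<open>F\<close> composed with
    \<open>A\<close>.\<close>
  define P where "P A \<longleftrightarrow> (det A \<noteq> 0 \<longrightarrow> (\<forall>F \<in> borel_measurable borel.
    (\<integral>\<^sup>+x. F x \<partial>lborel) = ennreal \<bar>det A\<bar> * (\<integral>\<^sup>+x. F (A *v x) \<partial>lborel)))" for A :: "real^'n^'n"
  have "P A"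
  proof (rule induct_matrix_elementary[where P=P])
    fix A B :: "real^'n^'n" assume A: "P A" and B: "P B"
    show "P (A ** B)" unfolding P_def
    proof (intro impI ballI)
      fix F :: "real^'n \<Rightarrow> ennreal"
      assume d: "det (A ** B) \<noteq> 0" and [measurable]: "F \<in> borel_measurable borel"
      have "det A \<noteq> 0" "det B \<noteq> 0" using d by (auto simp: det_mul)
      have "(\<integral>\<^sup>+x. F x \<partial>lborel) = ennreal \<bar>det A\<bar> * (\<integral>\<^sup>+x. F (A *v x) \<partial>lborel)"
        by (rule A[unfolded P_def, rule_format, OF \<open>det A \<noteq> 0\<close>]) measurable
      also have "(\<integral>\<^sup>+x. F (A *v x) \<partial>lborel) = ennreal \<bar>det B\<bar> * (\<integral>\<^sup>+x. F (A *v (B *v x)) \<partial>lborel)"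
        by (rule B[unfolded P_def, rule_format, OF \<open>det B \<noteq> 0\<close>]) measurable
      finally show "(\<integral>\<^sup>+x. F x \<partial>lborel) = ennreal \<bar>det (A ** B)\<bar> * (\<integral>\<^sup>+x. F ((A ** B) *v x) \<partial>lborel)"
        unfolding det_mul abs_mult matrix_vector_mul_assoc by (simp add: ennreal_mult mult.assoc)
    qed
  next
    fix A :: "real^'n^'n" and i assume "row i A = 0"
    then show "P A" by (simp add: P_def det_zero_row(1))
  next
    fix A :: "real^'n^'n" assume A: "\<And>i j. i \<noteq> j \<Longrightarrow> A $ i $ j = 0"
    have mv: "A *v x = (\<chi> i. A $ i $ i * x $ i)" for x
    proof -
      have "(\<Sum>j\<in>UNIV. A $ i $ j * x $ j) = A $ i $ i * x $ i" for i
      proof -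
        have "(\<Sum>j\<in>UNIV. A $ i $ j * x $ j) = (\<Sum>j\<in>UNIV. if j = i then A $ i $ j * x $ j else 0)"
          by (rule sum.cong) (simp_all add: A)
        then show ?thesis by simp
      qed
      then show ?thesis by (simp add: matrix_vector_mult_def)
    qed
    have d: "det A = (\<Prod>i\<in>UNIV. A $ i $ i)" using A by (rule det_diagonal)
    show "P A"
      unfolding P_def d mv
      by (auto intro!: nn_integral_lborel_diagonal[where d="\<lambda>i. A $ i $ i"] simp: prod_zero_iff)
  next
    fix m n :: 'n assume "m \<noteq> n"
    let ?A = "(\<chi> i j. mat 1 $ i $ Transposition.transpose m n j) :: real^'n^'n"
    have mv: "?A *v x = (\<chi> i. x $ Transposition.transpose m n i)" for x
    proof -
      have "i = Transposition.transpose m n j \<longleftrightarrow> j = Transposition.transpose m n i" for i j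
        by (metis transpose_involutory)
      then have "(\<Sum>j\<in>UNIV. (mat 1 :: real^'n^'n) $ i $ Transposition.transpose m n j * x $ j) =
          (\<Sum>j\<in>UNIV. if j = Transposition.transpose m n i then x $ j else 0)" for i
        by (intro sum.cong) (auto simp: mat_def)
      then show ?thesis by (simp add: matrix_vector_mult_def)
    qed
    have "det ?A = of_int (sign (Transposition.transpose m n)) * det (mat 1 :: real^'n^'n)"
      by (rule det_permute_columns) (simp add: permutes_swap_id)
    then have "det ?A = -1" using \<open>m \<noteq> n\<close> by (simp add: sign_swap_id)
    then show "P ?A" unfolding P_def mv by (simp add: nn_integral_lborel_transpose)
  next
    fix m n :: 'n and c :: real assume mn: "m \<noteq> n"
    let ?A = "(\<chi> i j. if i = m \<and> j = n then c else of_bool (i = j)) :: real^'n^'n"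
    have mv: "?A *v x = (\<chi> i. if i = m then x $ m + c * x $ n else x $ i)" for x
    proof -
      have "(\<Sum>j\<in>UNIV. (if i = m \<and> j = n then c else of_bool (i = j)) * x $ j) =
         (if i = m then x $ m + c * x $ n else x $ i)" for i
      proof -
        have "(\<Sum>j\<in>UNIV. (if i = m \<and> j = n then c else of_bool (i = j)) * x $ j) =
          (\<Sum>j\<in>UNIV. (if j = i then x $ j else 0) + (if j = n then if i = m then c * x $ j else 0 else 0))"
          using mn by (intro sum.cong) auto
        also have "\<dots> = x $ i + (if i = m then c * x $ n else 0)"
          by (simp add: sum.distrib)
        finally show ?thesis by simp
      qed
      then show ?thesis by (simp add: matrix_vector_mult_def)
    qed
    have "det ?A = det (\<chi> k. if k = m then row m (mat 1 :: real^'n^'n) + c *s row n (mat 1) else row k (mat 1))"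
      using mn by (intro arg_cong[where f=det]) (auto simp: vec_eq_iff row_def mat_def)
    also have "\<dots> = 1" by (subst det_row_operation[OF mn]) simp
    finally have "det ?A = 1" .
    then show "P ?A" unfolding P_def mv by (simp add: nn_integral_lborel_shear mn)
  qed
  then show ?thesis using assms unfolding P_def by blast
qed

section \<open>Symmetric positive definite matrices\<close>

lemma inner_matrix_symm:
  fixes S :: "real^'n^'n"
  assumes "transpose S = S"
  shows "x \<bullet> (S *v y) = (S *v x) \<bullet> y"
  using assms by (metis dot_lmul_matrix vector_transpose_matrix)

lemma sym_pos_def_mat_invertible:
  assumes "sym_pos_def_mat S"
  shows "invertible S"
proof -
  have "x = 0" if "S *v x = 0" for x
    using assms that unfolding sym_pos_def_mat_def by (metis inner_zero_right less_irrefl)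
  then show ?thesis
    unfolding invertible_left_inverse matrix_left_invertible_ker by blast
qed

lemma sym_pos_def_mat_matrix_inv:
  assumes S: "sym_pos_def_mat S"
  shows "sym_pos_def_mat (matrix_inv S)"
proof -
  have inv: "invertible S" by (rule sym_pos_def_mat_invertible[OF S])
  have "S ** transpose (matrix_inv S) = transpose (matrix_inv S ** S)"
    using S by (simp add: matrix_transpose_mul sym_pos_def_mat_def)
  then have "S ** transpose (matrix_inv S) = mat 1" by (simp add: matrix_inv_left[OF inv] transpose_mat)
  then have sym: "transpose (matrix_inv S) = matrix_inv S"
    using matrix_inv_eqI by metis
  have "0 < x \<bullet> (matrix_inv S *v x)" if "x \<noteq> 0" for x
  proof -
    let ?y = "matrix_inv S *v x"
    have x: "S *v ?y = x" by (simp add: matrix_inv_mult_vec inv)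
    with that have "?y \<noteq> 0" by auto
    then have "0 < ?y \<bullet> (S *v ?y)" using S by (simp add: sym_pos_def_mat_def)
    then show ?thesis by (simp add: x inner_commute)
  qed
  with sym show ?thesis by (simp add: sym_pos_def_mat_def)
qed

text \<open>Gram-Schmidt for the inner product given by \<open>T\<close>: fewer than CARD('m)
  vectors \<open>T *v b j\<close> do not span the space, so a nonzero vector orthogonal to all of
  them exists and is normalised. The free index set \<open>J\<close> serves the induction.\<close>

lemma sym_pos_def_mat_orthonormal_family:
  fixes T :: "real^'m^'m" and J :: "'m set"
  assumes T: "sym_pos_def_mat T"
  shows "\<exists>b. \<forall>i\<in>J. \<forall>j\<in>J. b i \<bullet> (T *v b j) = of_bool (i = j)"
proof -
  have sym: "transpose T = T" using T by (simp add: sym_pos_def_mat_def)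
  have "finite J" by simp
  then show ?thesis
  proof (induction J)
    case empty
    show ?case by simp
  next
    case (insert k J)
    then obtain b where b: "b i \<bullet> (T *v b j) = of_bool (i = j)" if "i \<in> J" "j \<in> J" for i j
      by blast
    have "card J < CARD('m)"
      using insert.hyps by (metis card_insert_disjoint card_mono finite less_eq_Suc_le subset_UNIV)
    moreover have "dim ((\<lambda>j. T *v b j) ` J) \<le> card ((\<lambda>j. T *v b j) ` J)"
      by (rule dim_le_card') simp
    moreover have "card ((\<lambda>j. T *v b j) ` J) \<le> card J" by (rule card_image_le) simp
    ultimately have "dim ((\<lambda>j. T *v b j) ` J) < DIM(real^'m)" by simp
    then obtain x where x: "x \<noteq> 0" "\<And>y. y \<in> span ((\<lambda>j. T *v b j) ` J) \<Longrightarrow> orthogonal x y"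
      by (rule orthogonal_to_subspace_exists) blast
    have pos: "0 < x \<bullet> (T *v x)" using T x(1) by (simp add: sym_pos_def_mat_def)
    have o: "x \<bullet> (T *v b j) = 0" if "j \<in> J" for j
      using x(2)[of "T *v b j"] that by (simp add: span_base orthogonal_def)
    define b' where "b' = b(k := x /\<^sub>R sqrt (x \<bullet> (T *v x)))"
    have "b' i \<bullet> (T *v b' j) = of_bool (i = j)" if "i \<in> insert k J" "j \<in> insert k J" for i j
    proof -
      have "b j \<bullet> (T *v x) = 0" if "j \<in> J" for j
        using o[OF that] inner_matrix_symm[OF sym, of "b j" x] by (metis inner_commute)
      moreover have "inverse (sqrt a) * (inverse (sqrt a) * a) = 1" if "a > 0" for a :: real
      proof -
        have "inverse (sqrt a) * (inverse (sqrt a) * a) = a / (sqrt a)\<^sup>2"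
          by (simp add: power2_eq_square field_simps)
        then show ?thesis using that by simp
      qed
      ultimately show ?thesis
        using that insert.hyps o b pos
        by (auto simp: b'_def matrix_vector_mult_scaleR)
    qed
    then show ?case by blast
  qed
qed

text \<open>The columns of \<open>A\<close> are an orthonormal basis for the inner product of
  \<open>matrix_inv S\<close>, so \<open>transpose A ** matrix_inv S ** A\<close> is the identity;
  inverting gives the factorisation. It plays the part of a Cholesky factor in whitening the
  Gaussian.\<close>

lemma sym_pos_def_mat_factor:
  assumes S: "sym_pos_def_mat S"
  obtains A :: "real^'m^'m" where "A ** transpose A = S" "det A \<noteq> 0" "det S = (det A)\<^sup>2"
    "\<And>x. (A *v x) \<bullet> (matrix_inv S *v (A *v x)) = x \<bullet> x"
proof -
  let ?T = "matrix_inv S"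
  obtain b :: "'m \<Rightarrow> real^'m" where b: "\<And>i j. b i \<bullet> (?T *v b j) = of_bool (i = j)"
    using sym_pos_def_mat_orthonormal_family[OF sym_pos_def_mat_matrix_inv[OF S], of UNIV] by auto
  define A where "A = (\<chi> i j. b j $ i)"
  have Aax: "A *v axis j 1 = b j" for j
    by (simp add: A_def matrix_vector_mult_basis column_def vec_eq_iff)
  have comp: "(transpose A ** (?T ** A)) $ i $ j = of_bool (i = j)" for i j
  proof -
    have "(transpose A ** (?T ** A)) $ i $ j = axis i 1 \<bullet> (transpose A *v (?T *v (A *v axis j 1)))"
      by (simp only: matrix_vector_mul_assoc matrix_mul_assoc)
         (simp add: inner_axis' matrix_vector_mult_basis column_def)
    also have "\<dots> = (A *v axis i 1) \<bullet> (?T *v (A *v axis j 1))"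
      by (metis dot_lmul_matrix vector_transpose_matrix transpose_transpose)
    finally show ?thesis by (simp add: Aax b)
  qed
  have eq: "transpose A ** (?T ** A) = mat 1"
    by (simp add: vec_eq_iff comp mat_def)
  then have "(transpose A ** ?T) ** A = mat 1" by (simp add: matrix_mul_assoc)
  then have "A ** (transpose A ** ?T) = mat 1" by (rule matrix_left_right_inverse[THEN iffD1])
  then have AT: "(A ** transpose A) ** ?T = mat 1" by (simp add: matrix_mul_assoc)
  then have "?T ** (A ** transpose A) = mat 1" by (rule matrix_left_right_inverse[THEN iffD1])
  then have "S = S ** (?T ** (A ** transpose A))" by simp
  also have "\<dots> = A ** transpose A"
    by (simp add: matrix_mul_assoc matrix_inv_right[OF sym_pos_def_mat_invertible[OF S]])
  finally have 1: "A ** transpose A = S" by simp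
  have inv: "invertible A" using \<open>A ** (transpose A ** ?T) = mat 1\<close> invertible_right_inverse by blast
  have "(A *v x) \<bullet> (?T *v (A *v x)) = x \<bullet> x" for x
  proof -
    have "(A *v x) \<bullet> (?T *v (A *v x)) = x \<bullet> (transpose A *v (?T *v (A *v x)))"
      by (metis dot_lmul_matrix vector_transpose_matrix transpose_transpose)
    also have "\<dots> = x \<bullet> ((transpose A ** (?T ** A)) *v x)"
      by (simp add: matrix_vector_mul_assoc matrix_mul_assoc)
    finally show ?thesis by (simp add: eq)
  qed
  moreover have "det S = (det A)\<^sup>2" using 1 by (metis det_mul det_transpose power2_eq_square)
  ultimately show ?thesis using that[of A] 1 inv by (simp add: invertible_det_nz)
qed

lemma sym_pos_def_mat_det_pos: "sym_pos_def_mat S \<Longrightarrow> 0 < det S"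
  by (erule sym_pos_def_mat_factor) simp

section \<open>Gaussian vectors\<close>

lemma prob_space_std_normal: "prob_space std_normal"
  unfolding std_normal_def by (rule prob_space_normal_density) simp

lemma sets_std_normal [simp, measurable_cong]: "sets std_normal = sets borel"
  by (simp add: std_normal_def)

lemma space_std_normal [simp]: "space std_normal = UNIV"
  by (simp add: std_normal_def)

lemma nn_integral_std_normal:
  assumes [measurable]: "F \<in> borel_measurable borel"
  shows "(\<integral>\<^sup>+x. F x \<partial>std_normal) = (\<integral>\<^sup>+x. ennreal (std_normal_density x) * F x \<partial>lborel)"
  unfolding std_normal_def by (simp add: nn_integral_density)

lemma sets_gaussian_vec [simp, measurable_cong]: "sets (gaussian_vec S) = sets borel"
  by (simp add: gaussian_vec_def)

lemma space_gaussian_vec [simp]: "space (gaussian_vec S) = UNIV"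
  by (simp add: gaussian_vec_def)

lemma borel_measurable_mvn_density [measurable]: "mvn_density S \<in> borel_measurable borel"
  unfolding mvn_density_def[abs_def] by measurable

lemma nn_integral_gaussian_vec:
  assumes [measurable]: "F \<in> borel_measurable borel"
  shows "(\<integral>\<^sup>+x. F x \<partial>gaussian_vec S) = (\<integral>\<^sup>+x. ennreal (mvn_density S x) * F x \<partial>lborel)"
  unfolding gaussian_vec_def by (simp add: nn_integral_density)

interpretation std_normal: prob_space std_normal by (rule prob_space_std_normal)
interpretation std_normals: product_prob_space "\<lambda>_. std_normal" UNIV ..

lemma PiM_std_normal_eq_density:
  assumes "finite I"
  shows "PiM I (\<lambda>_. std_normal) =
    density (PiM I (\<lambda>_. lborel)) (\<lambda>f. \<Prod>i\<in>I. ennreal (std_normal_density (f i)))"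
proof (rule sym, rule std_normals.PiM_eqI[OF assms])
  interpret L: product_sigma_finite "\<lambda>_. lborel :: real measure" ..
  show "sets (density (PiM I (\<lambda>_. lborel)) (\<lambda>f. \<Prod>i\<in>I. ennreal (std_normal_density (f i)))) =
      sets (PiM I (\<lambda>_. std_normal))"
    by (simp cong: sets_PiM_cong)
  fix A :: "'a \<Rightarrow> real set" assume A: "\<And>i. i \<in> I \<Longrightarrow> A i \<in> sets std_normal"
  have [measurable]: "Pi\<^sub>E I A \<in> sets (PiM I (\<lambda>_. lborel))"
    using A assms by (intro sets_PiM_I_finite) auto
  have "emeasure (density (PiM I (\<lambda>_. lborel)) (\<lambda>f. \<Prod>i\<in>I. ennreal (std_normal_density (f i)))) (Pi\<^sub>E I A) =
      (\<integral>\<^sup>+f. (\<Prod>i\<in>I. ennreal (std_normal_density (f i))) * indicator (Pi\<^sub>E I A) f \<partial>PiM I (\<lambda>_. lborel))"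
    by (subst emeasure_density) auto
  also have "\<dots> = (\<integral>\<^sup>+f. (\<Prod>i\<in>I. ennreal (std_normal_density (f i)) * indicator (A i) (f i)) \<partial>PiM I (\<lambda>_. lborel))"
  proof (rule nn_integral_cong)
    fix f assume "f \<in> space (PiM I (\<lambda>_. lborel :: real measure))"
    then have "f \<in> extensional I" by (simp add: space_PiM PiE_def)
    then have "indicator (Pi\<^sub>E I A) f = (\<Prod>i\<in>I. indicator (A i) (f i) :: ennreal)"
      using assms by (auto simp: indicator_def PiE_iff)
    then show "(\<Prod>i\<in>I. ennreal (std_normal_density (f i))) * indicator (Pi\<^sub>E I A) f =
        (\<Prod>i\<in>I. ennreal (std_normal_density (f i)) * indicator (A i) (f i))"
      by (simp add: prod.distrib)
  qed
  also have "\<dots> = (\<Prod>i\<in>I. \<integral>\<^sup>+x. ennreal (std_normal_density x) * indicator (A i) x \<partial>lborel)"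
    using A assms by (intro L.product_nn_integral_prod) auto
  also have "\<dots> = (\<Prod>i\<in>I. emeasure std_normal (A i))"
    using A by (intro prod.cong) (auto simp: std_normal_def emeasure_density)
  finally show "emeasure (density (PiM I (\<lambda>_. lborel)) (\<lambda>f. \<Prod>i\<in>I. ennreal (std_normal_density (f i)))) (Pi\<^sub>E I A) =
      (\<Prod>i\<in>I. emeasure std_normal (A i))" .
qed

text \<open>Whitening: the substitution by \<open>A\<close> turns the exponent into minus half the
  squared norm, and the Jacobian cancels the square root of \<open>det S\<close>. Integrals under
  the Gaussian become integrals over independent standard normal coordinates.\<close>

lemma nn_integral_gaussian_vec_eq_PiM:
  fixes S :: "real^'m^'m"
  assumes S: "sym_pos_def_mat S"
  obtains A :: "real^'m^'m" where "A ** transpose A = S" "\<And>x. (A *v x) \<bullet> (matrix_inv S *v (A *v x)) = x \<bullet> x"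
    "\<And>F. F \<in> borel_measurable borel \<Longrightarrow>
      (\<integral>\<^sup>+x. F x \<partial>gaussian_vec S) = (\<integral>\<^sup>+f. F (A *v vec_lambda f) \<partial>PiM UNIV (\<lambda>_. std_normal))"
proof (rule sym_pos_def_mat_factor[OF S])
  fix A :: "real^'m^'m" assume A: "A ** transpose A = S" "det A \<noteq> 0" "det S = (det A)\<^sup>2"
    "\<And>x. (A *v x) \<bullet> (matrix_inv S *v (A *v x)) = x \<bullet> x"
  have "(\<integral>\<^sup>+x. F x \<partial>gaussian_vec S) = (\<integral>\<^sup>+f. F (A *v vec_lambda f) \<partial>PiM UNIV (\<lambda>_. std_normal))"
    if [measurable]: "F \<in> borel_measurable borel" for F
  proof -
    have [measurable]: "vec_lambda \<in> PiM UNIV (\<lambda>_. lborel :: real measure) \<rightarrow>\<^sub>M (borel :: (real^'m) measure)"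
      using measurable_vec_lambda_PiM by (simp cong: measurable_cong_sets sets_PiM_cong)
    have dens: "ennreal \<bar>det A\<bar> * ennreal (mvn_density S (A *v x)) = (\<Prod>i\<in>UNIV. ennreal (std_normal_density (x $ i)))" for x
    proof -
      have "\<bar>det A\<bar> * mvn_density S (A *v x) = exp (- (x \<bullet> x) / 2) / sqrt ((2 * pi) ^ CARD('m))"
        using A(2) by (simp add: mvn_density_def A(3,4) real_sqrt_mult)
      also have "\<dots> = (\<Prod>i\<in>UNIV. std_normal_density (x $ i))"
      proof -
        have "(\<Prod>i\<in>UNIV. std_normal_density (x $ i)) = (\<Prod>i\<in>UNIV. exp (- (x $ i)\<^sup>2 / 2) / sqrt (2 * pi))"
          by (simp add: std_normal_density_def)
        also have "\<dots> = exp (\<Sum>i\<in>UNIV. - (x $ i)\<^sup>2 / 2) / sqrt (2 * pi) ^ CARD('m)"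
          by (simp only: prod_dividef exp_sum[OF finite] prod_constant)
        also have "(\<Sum>i\<in>UNIV. - (x $ i)\<^sup>2 / 2) = - (x \<bullet> x) / 2"
          by (simp add: inner_vec_def power2_eq_square sum_negf sum_divide_distrib)
        finally show ?thesis by (simp only: real_sqrt_power)
      qed
      finally have "ennreal (\<bar>det A\<bar> * mvn_density S (A *v x)) = ennreal (\<Prod>i\<in>UNIV. std_normal_density (x $ i))"
        by simp
      then show ?thesis
        by (simp add: prod_ennreal ennreal_mult' )
    qed
    have "(\<integral>\<^sup>+x. F x \<partial>gaussian_vec S) = (\<integral>\<^sup>+x. ennreal (mvn_density S x) * F x \<partial>lborel)"
      by (rule nn_integral_gaussian_vec) measurable
    also have "\<dots> = ennreal \<bar>det A\<bar> * (\<integral>\<^sup>+x. ennreal (mvn_density S (A *v x)) * F (A *v x) \<partial>lborel)"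
      by (rule nn_integral_lborel_linear[OF A(2)]) measurable
    also have "\<dots> = (\<integral>\<^sup>+x. (\<Prod>i\<in>UNIV. ennreal (std_normal_density (x $ i))) * F (A *v x) \<partial>lborel)"
      by (subst nn_integral_cmult[symmetric]) (auto simp: dens[symmetric] mult.assoc)
    also have "\<dots> = (\<integral>\<^sup>+f. (\<Prod>i\<in>UNIV. ennreal (std_normal_density (f i))) * F (A *v vec_lambda f) \<partial>PiM UNIV (\<lambda>_. lborel))"
      by (subst nn_integral_lborel_vec) (auto intro!: nn_integral_cong)
    also have "\<dots> = (\<integral>\<^sup>+f. F (A *v vec_lambda f) \<partial>PiM UNIV (\<lambda>_. std_normal))"
      by (simp add: PiM_std_normal_eq_density nn_integral_density)
    finally show ?thesis .
  qed
  from that[OF A(1,4) this] show ?thesis .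
qed

lemma prob_space_gaussian_vec:
  fixes S :: "real^'m^'m"
  assumes "sym_pos_def_mat S"
  shows "prob_space (gaussian_vec S)"
proof (rule nn_integral_gaussian_vec_eq_PiM[OF assms])
  fix A :: "real^'m^'m" assume A: "\<And>F. F \<in> borel_measurable borel \<Longrightarrow>
      (\<integral>\<^sup>+x. F x \<partial>gaussian_vec S) = (\<integral>\<^sup>+f. F (A *v vec_lambda f) \<partial>PiM UNIV (\<lambda>_. std_normal))"
  have "emeasure (gaussian_vec S) (space (gaussian_vec S)) = (\<integral>\<^sup>+x. 1 \<partial>gaussian_vec S)" by simp
  also have "\<dots> = emeasure (PiM UNIV (\<lambda>_. std_normal)) (space (PiM (UNIV::'m set) (\<lambda>_. std_normal)))"
    by (subst A) auto
  also have "\<dots> = 1" by (rule std_normals.emeasure_space_1)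
  finally show ?thesis by (rule prob_spaceI)
qed


section \<open>Gaussian moments and the resampling identity\<close>

lemma nn_integral_lborel_translate:
  fixes F :: "'a::euclidean_space \<Rightarrow> ennreal"
  assumes [measurable]: "F \<in> borel_measurable borel"
  shows "(\<integral>\<^sup>+x. F (c + x) \<partial>lborel) = (\<integral>\<^sup>+x. F x \<partial>lborel)"
proof -
  have "(\<integral>\<^sup>+x. F x \<partial>lborel) = (\<integral>\<^sup>+x. F x \<partial>distr lborel borel ((+) c))"
    by (simp only: lborel_distr_plus)
  then show ?thesis by (simp add: nn_integral_distr)
qed

text \<open>Completing the square leaves a constant times the normal density with mean
  \<open>\<beta> / (1 + 2 * t)\<close> and variance \<open>1 / (1 + 2 * t)\<close>. Values of
  \<open>t\<close> between -1/2 and 0 are included on purpose: positive exponents occur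
  below.\<close>

lemma nn_integral_std_normal_exp:
  assumes t: "0 < 1 + 2 * t"
  shows "(\<integral>\<^sup>+x. ennreal (exp (- t * x\<^sup>2 + \<beta> * x)) \<partial>std_normal) =
    ennreal (exp (\<beta>\<^sup>2 / (2 * (1 + 2 * t))) / sqrt (1 + 2 * t))"
proof -
  let ?s = "1 / sqrt (1 + 2 * t)" and ?\<mu> = "\<beta> / (1 + 2 * t)"
  have eq: "std_normal_density x * exp (- t * x\<^sup>2 + \<beta> * x) =
      exp (\<beta>\<^sup>2 / (2 * (1 + 2 * t))) / sqrt (1 + 2 * t) * normal_density ?\<mu> ?s x" for x
  proof -
    have s: "?s\<^sup>2 = 1 / (1 + 2 * t)" using t by (simp add: power_divide)
    have "- x\<^sup>2 / 2 + (- t * x\<^sup>2 + \<beta> * x) = \<beta>\<^sup>2 / (2 * (1 + 2 * t)) + - (x - ?\<mu>)\<^sup>2 / (2 * ?s\<^sup>2)"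
    proof -
      define d where "d = 1 + 2 * t"
      define \<mu> where "\<mu> = \<beta> / d"
      have d: "0 < d" and t': "t = (d - 1) / 2" using t by (simp_all add: d_def)
      have \<beta>: "\<beta> = \<mu> * d" using d by (simp add: \<mu>_def)
      have "\<beta>\<^sup>2 / (2 * d) = \<mu>\<^sup>2 * d / 2" using d by (simp add: \<beta> power2_eq_square)
      moreover have "- (x - \<mu>)\<^sup>2 / (2 * (1 / d)) = - (d * (x - \<mu>)\<^sup>2 / 2)" by simp
      moreover have "- x\<^sup>2 / 2 + (- t * x\<^sup>2 + \<beta> * x) = \<mu>\<^sup>2 * d / 2 + - (d * (x - \<mu>)\<^sup>2 / 2)"
        unfolding t' \<beta> by (simp add: power2_eq_square field_simps)
      ultimately show ?thesis unfolding s unfolding d_def[symmetric] \<mu>_def[symmetric] by (simp only:)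
    qed
    then have e: "exp (- x\<^sup>2 / 2) * exp (- t * x\<^sup>2 + \<beta> * x) =
        exp (\<beta>\<^sup>2 / (2 * (1 + 2 * t))) * exp (- (x - ?\<mu>)\<^sup>2 / (2 * ?s\<^sup>2))"
      by (metis exp_add)
    have q: "1 / sqrt (2 * pi * ?s\<^sup>2) = sqrt (1 + 2 * t) / sqrt (2 * pi)"
      unfolding s by (simp add: real_sqrt_divide)
    have "std_normal_density x * exp (- t * x\<^sup>2 + \<beta> * x) =
        1 / sqrt (2 * pi) * (exp (\<beta>\<^sup>2 / (2 * (1 + 2 * t))) * exp (- (x - ?\<mu>)\<^sup>2 / (2 * ?s\<^sup>2)))"
      unfolding std_normal_density_def e[symmetric] by simp
    also have "\<dots> = exp (\<beta>\<^sup>2 / (2 * (1 + 2 * t))) / sqrt (1 + 2 * t) * normal_density ?\<mu> ?s x"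
      unfolding normal_density_def q using t by simp
    finally show ?thesis .
  qed
  have "(\<integral>\<^sup>+x. ennreal (exp (- t * x\<^sup>2 + \<beta> * x)) \<partial>std_normal) =
      (\<integral>\<^sup>+x. ennreal (std_normal_density x * exp (- t * x\<^sup>2 + \<beta> * x)) \<partial>lborel)"
    by (subst nn_integral_std_normal) (auto simp: ennreal_mult)
  also have "\<dots> = ennreal (exp (\<beta>\<^sup>2 / (2 * (1 + 2 * t))) / sqrt (1 + 2 * t)) *
      (\<integral>\<^sup>+x. ennreal (normal_density ?\<mu> ?s x) \<partial>lborel)"
    unfolding eq by (subst nn_integral_cmult[symmetric]) (use t in \<open>simp_all add: ennreal_mult[symmetric]\<close>)
  also have "(\<integral>\<^sup>+x. ennreal (normal_density ?\<mu> ?s x) \<partial>lborel) = 1"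
    using t by (subst nn_integral_eq_integral) auto
  finally show ?thesis by simp
qed

lemma nn_integral_PiM_std_normal_exp:
  assumes t: "0 < 1 + 2 * t" and I: "finite I"
  shows "(\<integral>\<^sup>+f. ennreal (exp (- t * (\<Sum>i\<in>I. (f i)\<^sup>2) + (\<Sum>i\<in>I. \<beta> i * f i))) \<partial>PiM I (\<lambda>_. std_normal)) =
    ennreal (exp ((\<Sum>i\<in>I. (\<beta> i)\<^sup>2) / (2 * (1 + 2 * t))) / sqrt (1 + 2 * t) ^ card I)"
proof -
  have "(\<integral>\<^sup>+f. ennreal (exp (- t * (\<Sum>i\<in>I. (f i)\<^sup>2) + (\<Sum>i\<in>I. \<beta> i * f i))) \<partial>PiM I (\<lambda>_. std_normal)) =
      (\<integral>\<^sup>+f. (\<Prod>i\<in>I. ennreal (exp (- t * (f i)\<^sup>2 + \<beta> i * f i))) \<partial>PiM I (\<lambda>_. std_normal))"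
    using I by (simp add: prod_ennreal exp_sum[symmetric] sum.distrib sum_distrib_left sum_negf sum_subtractf)
  also have "\<dots> = (\<Prod>i\<in>I. ennreal (exp ((\<beta> i)\<^sup>2 / (2 * (1 + 2 * t))) / sqrt (1 + 2 * t)))"
    using I t by (subst std_normals.product_nn_integral_prod) (auto simp: nn_integral_std_normal_exp[OF t, simplified])
  also have "\<dots> = ennreal (exp ((\<Sum>i\<in>I. (\<beta> i)\<^sup>2) / (2 * (1 + 2 * t))) / sqrt (1 + 2 * t) ^ card I)"
    using I t by (simp add: prod_ennreal prod_dividef exp_sum sum_divide_distrib)
  finally show ?thesis .
qed

text \<open>The moment generating function: after whitening, \<open>u\<close> becomes
  \<open>transpose A *v u\<close>, whose squared norm is \<open>u \<bullet> (S *v u)\<close>. It is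
  later read from right to left, to replace the exponential of a quadratic form by an average of
  exponentials of linear forms.\<close>

lemma nn_integral_gaussian_vec_exp_inner:
  fixes S :: "real^'m^'m"
  assumes S: "sym_pos_def_mat S"
  shows "(\<integral>\<^sup>+x. ennreal (exp (u \<bullet> x)) \<partial>gaussian_vec S) = ennreal (exp ((u \<bullet> (S *v u)) / 2))"
proof (rule nn_integral_gaussian_vec_eq_PiM[OF S])
  fix A :: "real^'m^'m" assume A: "A ** transpose A = S"
    and int: "\<And>F. F \<in> borel_measurable borel \<Longrightarrow>
      (\<integral>\<^sup>+x. F x \<partial>gaussian_vec S) = (\<integral>\<^sup>+f. F (A *v vec_lambda f) \<partial>PiM UNIV (\<lambda>_. std_normal))"
  let ?w = "transpose A *v u"
  have *: "u \<bullet> (A *v v) = ?w \<bullet> v" for v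
    by (metis dot_lmul_matrix vector_transpose_matrix transpose_transpose)
  have "(\<integral>\<^sup>+x. ennreal (exp (u \<bullet> x)) \<partial>gaussian_vec S) =
      (\<integral>\<^sup>+f. ennreal (exp (- 0 * (\<Sum>i\<in>UNIV. (f i)\<^sup>2) + (\<Sum>i\<in>UNIV. ?w $ i * f i))) \<partial>PiM UNIV (\<lambda>_. std_normal))"
    by (subst int) (simp_all only: *, simp_all add: inner_vec_def)
  also have "\<dots> = ennreal (exp ((?w \<bullet> ?w) / 2))"
    by (subst nn_integral_PiM_std_normal_exp) (auto simp: inner_vec_def power2_eq_square)
  also have "?w \<bullet> ?w = u \<bullet> (S *v u)"
    by (simp only: *[symmetric] matrix_vector_mul_assoc A)
  finally show ?thesis .
qed

text \<open>After whitening the form is a sum of CARD('m) independent squared standard normals; this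
  is the Laplace transform of the chi-squared law.\<close>

lemma nn_integral_gaussian_vec_exp_quadratic:
  fixes S :: "real^'m^'m"
  assumes S: "sym_pos_def_mat S" and t: "0 < 1 + 2 * t"
  shows "(\<integral>\<^sup>+x. ennreal (exp (- t * (x \<bullet> (matrix_inv S *v x)))) \<partial>gaussian_vec S) =
    ennreal (1 / sqrt (1 + 2 * t) ^ CARD('m))"
proof (rule nn_integral_gaussian_vec_eq_PiM[OF S])
  fix A :: "real^'m^'m" assume A: "\<And>x. (A *v x) \<bullet> (matrix_inv S *v (A *v x)) = x \<bullet> x"
    and int: "\<And>F. F \<in> borel_measurable borel \<Longrightarrow>
      (\<integral>\<^sup>+x. F x \<partial>gaussian_vec S) = (\<integral>\<^sup>+f. F (A *v vec_lambda f) \<partial>PiM UNIV (\<lambda>_. std_normal))"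
  have "(\<integral>\<^sup>+x. ennreal (exp (- t * (x \<bullet> (matrix_inv S *v x)))) \<partial>gaussian_vec S) =
      (\<integral>\<^sup>+f. ennreal (exp (- t * (\<Sum>i\<in>(UNIV::'m set). (f i)\<^sup>2) + (\<Sum>i\<in>UNIV. 0 * f i))) \<partial>PiM UNIV (\<lambda>_. std_normal))"
    by (subst int) (simp_all only: A, simp_all add: inner_vec_def power2_eq_square)
  also have "\<dots> = ennreal (1 / sqrt (1 + 2 * t) ^ CARD('m))"
    by (subst nn_integral_PiM_std_normal_exp) (auto simp: t)
  finally show ?thesis .
qed

lemma nn_integral_std_normal_power_even:
  "(\<integral>\<^sup>+x. ennreal (x ^ (2 * k)) \<partial>std_normal) = ennreal (fact (2 * k) / (2 ^ k * fact k))"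
proof -
  have "(\<integral>\<^sup>+x. ennreal (x ^ (2 * k)) \<partial>std_normal) = (\<integral>\<^sup>+x. ennreal (std_normal_density x * x ^ (2 * k)) \<partial>lborel)"
    by (subst nn_integral_std_normal) (auto simp: ennreal_mult)
  also have "\<dots> = ennreal (\<integral>x. std_normal_density x * x ^ (2 * k) \<partial>lborel)"
    using std_normal_moment_even[of k]
    by (intro nn_integral_eq_integral) (auto simp: has_bochner_integral_iff)
  finally show ?thesis by (simp add: integral_std_normal_moment_even)
qed

text \<open>First two moments of a chi-squared variable. In the expanded square each of the m^2
  pairs contributes 1, and the m diagonal pairs contribute 2 more because a fourth moment is
  3.\<close>

lemma nn_integral_gaussian_vec_quadratic:
  fixes S :: "real^'m^'m"
  assumes S: "sym_pos_def_mat S"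
  shows "(\<integral>\<^sup>+x. ennreal (x \<bullet> (matrix_inv S *v x)) \<partial>gaussian_vec S) = ennreal (real CARD('m))"
    and "(\<integral>\<^sup>+x. ennreal ((x \<bullet> (matrix_inv S *v x))\<^sup>2) \<partial>gaussian_vec S) = ennreal (real CARD('m) * (real CARD('m) + 2))"
  unfolding atomize_conj
proof (rule nn_integral_gaussian_vec_eq_PiM[OF S])
  fix A :: "real^'m^'m" assume A: "\<And>x. (A *v x) \<bullet> (matrix_inv S *v (A *v x)) = x \<bullet> x"
    and int: "\<And>F. F \<in> borel_measurable borel \<Longrightarrow>
      (\<integral>\<^sup>+x. F x \<partial>gaussian_vec S) = (\<integral>\<^sup>+f. F (A *v vec_lambda f) \<partial>PiM UNIV (\<lambda>_. std_normal))"
  have m2: "(\<integral>\<^sup>+x. ennreal (x\<^sup>2) \<partial>std_normal) = 1"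
    using nn_integral_std_normal_power_even[of 1] by simp
  have "(\<integral>\<^sup>+x. ennreal (x ^ 4) \<partial>std_normal) = 3"
    using nn_integral_std_normal_power_even[of 2] by (simp add: fact_numeral)
  then have m4: "(\<integral>\<^sup>+x. ennreal (x\<^sup>2) * ennreal (x\<^sup>2) \<partial>std_normal) = 3"
    by (simp add: ennreal_mult[symmetric] power_add[symmetric])
  have m0: "emeasure std_normal UNIV = 1"
    using std_normal.emeasure_space_1 by simp
  have two: "(\<integral>\<^sup>+f. ennreal ((f i)\<^sup>2) * ennreal ((f j)\<^sup>2) \<partial>PiM UNIV (\<lambda>_. std_normal)) = (if i = j then 3 else 1)" for i j :: 'm
  proof -
    have "ennreal ((f i)\<^sup>2) * ennreal ((f j)\<^sup>2) =
      (\<Prod>k\<in>UNIV. (if k = i then ennreal ((f k)\<^sup>2) else 1) * (if k = j then ennreal ((f k)\<^sup>2) else 1))" for f :: "'m \<Rightarrow> real"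
      by (simp add: prod.distrib)
    then have "(\<integral>\<^sup>+f. ennreal ((f i)\<^sup>2) * ennreal ((f j)\<^sup>2) \<partial>PiM UNIV (\<lambda>_. std_normal)) =
      (\<Prod>k\<in>UNIV. \<integral>\<^sup>+x. (if k = i then ennreal (x\<^sup>2) else 1) * (if k = j then ennreal (x\<^sup>2) else 1) \<partial>std_normal)"
      by (simp only:) (rule std_normals.product_nn_integral_prod, auto)
    also have "\<dots> = (\<Prod>k\<in>UNIV. if k = i then (if i = j then 3 else 1) else 1)"
    proof (rule prod.cong[OF refl])
      fix k
      show "(\<integral>\<^sup>+x. (if k = i then ennreal (x\<^sup>2) else 1) * (if k = j then ennreal (x\<^sup>2) else 1) \<partial>std_normal) =
          (if k = i then (if i = j then 3 else 1) else 1)"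
        by (cases "k = i"; cases "k = j"; cases "i = j") (simp_all add: m0 m2 m4)
    qed
    finally show ?thesis by simp
  qed
  have one: "(\<integral>\<^sup>+f. ennreal ((f i)\<^sup>2) \<partial>PiM UNIV (\<lambda>_. std_normal)) = 1" for i :: 'm
  proof -
    have "ennreal ((f i)\<^sup>2) = (\<Prod>k\<in>UNIV. (if k = i then ennreal ((f k)\<^sup>2) else 1))" for f :: "'m \<Rightarrow> real"
      by simp
    then have "(\<integral>\<^sup>+f. ennreal ((f i)\<^sup>2) \<partial>PiM UNIV (\<lambda>_. std_normal)) =
      (\<Prod>k\<in>UNIV. \<integral>\<^sup>+x. (if k = i then ennreal (x\<^sup>2) else 1) \<partial>std_normal)"
      by (simp only:) (rule std_normals.product_nn_integral_prod, auto)
    also have "\<dots> = 1"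
    proof (rule prod.neutral, rule ballI)
      fix k
      show "(\<integral>\<^sup>+x. (if k = i then ennreal (x\<^sup>2) else 1) \<partial>std_normal) = 1"
        by (cases "k = i") (simp_all add: m0 m2)
    qed
    finally show ?thesis .
  qed
  have norm: "ennreal ((vec_lambda f :: real^'m) \<bullet> vec_lambda f) = (\<Sum>i\<in>UNIV. ennreal ((f i)\<^sup>2))" for f
    by (simp add: inner_vec_def power2_eq_square sum_ennreal)
  have 1: "(\<integral>\<^sup>+x. ennreal (x \<bullet> (matrix_inv S *v x)) \<partial>gaussian_vec S) = ennreal (real CARD('m))"
    by (subst int) (auto simp: A norm nn_integral_sum one ennreal_of_nat_eq_real_of_nat simp del: sum_ennreal)
  have "(\<integral>\<^sup>+x. ennreal ((x \<bullet> (matrix_inv S *v x))\<^sup>2) \<partial>gaussian_vec S) =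
      (\<integral>\<^sup>+f. (\<Sum>i\<in>UNIV. \<Sum>j\<in>UNIV. ennreal ((f i)\<^sup>2) * ennreal ((f j)\<^sup>2)) \<partial>PiM (UNIV :: 'm set) (\<lambda>_. std_normal))"
    by (subst int) (auto simp: A norm power2_eq_square[of "_ \<bullet> _"] ennreal_mult sum_product simp del: sum_ennreal)
  also have "\<dots> = (\<Sum>i\<in>UNIV. \<Sum>j\<in>(UNIV::'m set). if i = j then 3 else 1)"
    by (simp add: nn_integral_sum two del: sum_ennreal)
  also have "\<dots> = (\<Sum>i\<in>UNIV. \<Sum>j\<in>(UNIV::'m set). ennreal ((if j = i then 2 else 0) + 1))"
    by (intro sum.cong refl) auto
  also have "\<dots> = ennreal (\<Sum>i\<in>UNIV. \<Sum>j\<in>(UNIV::'m set). (if j = i then 2 else 0) + 1)"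
    by (subst sum_ennreal, simp)+ (auto simp: sum_nonneg)
  also have "(\<Sum>i\<in>UNIV. \<Sum>j\<in>(UNIV::'m set). (if j = i then 2 else 0) + 1) = real CARD('m) * (real CARD('m) + 2)"
    by (simp add: sum.distrib algebra_simps)
  finally show "(\<integral>\<^sup>+x. ennreal (x \<bullet> (matrix_inv S *v x)) \<partial>gaussian_vec S) = ennreal (real CARD('m)) \<and>
      (\<integral>\<^sup>+x. ennreal ((x \<bullet> (matrix_inv S *v x))\<^sup>2) \<partial>gaussian_vec S) = ennreal (real CARD('m) * (real CARD('m) + 2))"
    using 1 by blast
qed

text \<open>Here \<open>c \<bullet> \<phi>\<close> is the \<open>b\<close>-component of \<open>\<phi>\<close>. Exchanging it with \<open>x\<close> leaves the joint density
  invariant, and the exchange is a composition of translations in \<open>x\<close> and along \<open>b\<close>.\<close>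
lemma nn_integral_gaussian_vec_resample:
  fixes S :: "real^'m^'m"
  assumes S: "sym_pos_def_mat S" and b: "b \<bullet> (matrix_inv S *v b) = 1"
    and c: "c = matrix_inv S *v b"
    and [measurable]: "F \<in> borel_measurable borel"
  shows "(\<integral>\<^sup>+\<phi>. (\<integral>\<^sup>+x. F (\<phi> + (x - c \<bullet> \<phi>) *\<^sub>R b) \<partial>std_normal) \<partial>gaussian_vec S) = (\<integral>\<^sup>+\<phi>. F \<phi> \<partial>gaussian_vec S)"
proof -
  let ?T = "matrix_inv S" and ?\<rho> = "mvn_density S" and ?\<eta> = std_normal_density
  have sym: "transpose ?T = ?T" using sym_pos_def_mat_matrix_inv[OF S] by (simp add: sym_pos_def_mat_def)
  \<comment> \<open>By the normalisation of \<open>b\<close>, the quadratic form at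
    \<open>\<phi> - x *\<^sub>R b\<close> is that at \<open>\<phi>\<close> minus
    \<open>2 * x * (c \<bullet> \<phi>)\<close> plus \<open>x\<^sup>2\<close>. Adding the square of
    \<open>c \<bullet> \<phi>\<close> completes the square to
    \<open>(x - c \<bullet> \<phi>)\<^sup>2\<close>, so the two exponents agree.\<close>
  have exch: "?\<rho> (- (x *\<^sub>R b) + \<phi>) * ?\<eta> (c \<bullet> \<phi>) = ?\<rho> \<phi> * ?\<eta> (x - c \<bullet> \<phi>)" for x \<phi>
  proof -
    have "(- (x *\<^sub>R b) + \<phi>) \<bullet> (?T *v (- (x *\<^sub>R b) + \<phi>)) = \<phi> \<bullet> (?T *v \<phi>) - 2 * x * (c \<bullet> \<phi>) + x\<^sup>2"
    proof -
      have "b \<bullet> (?T *v \<phi>) = c \<bullet> \<phi>" by (simp add: c inner_matrix_symm[OF sym])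
      moreover have "\<phi> \<bullet> (?T *v b) = c \<bullet> \<phi>" by (simp add: c inner_commute)
      moreover have "- (x *\<^sub>R b) + \<phi> = \<phi> - x *\<^sub>R b" by simp
      ultimately show ?thesis
        by (simp add: matrix_vector_mult_diff_distrib matrix_vector_mult_scaleR inner_diff_left
          inner_diff_right b power2_eq_square right_diff_distrib)
    qed
    then have "exp (- ((- (x *\<^sub>R b) + \<phi>) \<bullet> (?T *v (- (x *\<^sub>R b) + \<phi>))) / 2) * exp (- (c \<bullet> \<phi>)\<^sup>2 / 2) =
      exp (- (\<phi> \<bullet> (?T *v \<phi>)) / 2) * exp (- (x - c \<bullet> \<phi>)\<^sup>2 / 2)"
      unfolding exp_add[symmetric] by (simp add: power2_eq_square field_simps)
    then show ?thesis
      by (simp add: mvn_density_def std_normal_density_def field_simps)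
  qed
  have \<rho>0: "0 \<le> ?\<rho> x" for x
    using sym_pos_def_mat_det_pos[OF S] by (simp add: mvn_density_def)
  have "(\<integral>\<^sup>+\<phi>. (\<integral>\<^sup>+x. F (\<phi> + (x - c \<bullet> \<phi>) *\<^sub>R b) \<partial>std_normal) \<partial>gaussian_vec S) =
      (\<integral>\<^sup>+\<phi>. ennreal (?\<rho> \<phi>) * (\<integral>\<^sup>+x. ennreal (?\<eta> x) * F (\<phi> + (x - c \<bullet> \<phi>) *\<^sub>R b) \<partial>lborel) \<partial>lborel)"
    by (subst nn_integral_gaussian_vec) (auto simp: nn_integral_std_normal)
  also have "\<dots> = (\<integral>\<^sup>+\<phi>. ennreal (?\<rho> \<phi>) * (\<integral>\<^sup>+x. ennreal (?\<eta> (c \<bullet> \<phi> + x)) * F (\<phi> + x *\<^sub>R b) \<partial>lborel) \<partial>lborel)"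
  proof (rule nn_integral_cong)
    fix \<phi>
    show "ennreal (?\<rho> \<phi>) * (\<integral>\<^sup>+x. ennreal (?\<eta> x) * F (\<phi> + (x - c \<bullet> \<phi>) *\<^sub>R b) \<partial>lborel) =
        ennreal (?\<rho> \<phi>) * (\<integral>\<^sup>+x. ennreal (?\<eta> (c \<bullet> \<phi> + x)) * F (\<phi> + x *\<^sub>R b) \<partial>lborel)"
      using nn_integral_lborel_translate[of "\<lambda>x. ennreal (?\<eta> x) * F (\<phi> + (x - c \<bullet> \<phi>) *\<^sub>R b)" "c \<bullet> \<phi>"]
      by simp
  qed
  also have "\<dots> = (\<integral>\<^sup>+\<phi>. (\<integral>\<^sup>+x. ennreal (?\<rho> \<phi>) * ennreal (?\<eta> (c \<bullet> \<phi> + x)) * F (\<phi> + x *\<^sub>R b) \<partial>lborel) \<partial>lborel)"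
    by (subst nn_integral_cmult[symmetric]) (auto simp: mult.assoc)
  also have "\<dots> = (\<integral>\<^sup>+x. (\<integral>\<^sup>+\<phi>. ennreal (?\<rho> \<phi>) * ennreal (?\<eta> (c \<bullet> \<phi> + x)) * F (\<phi> + x *\<^sub>R b) \<partial>lborel) \<partial>lborel)"
    by (rule lborel_pair.Fubini') measurable
  also have "\<dots> = (\<integral>\<^sup>+x. (\<integral>\<^sup>+\<phi>. ennreal (?\<rho> (- (x *\<^sub>R b) + \<phi>)) * ennreal (?\<eta> (c \<bullet> \<phi>)) * F \<phi> \<partial>lborel) \<partial>lborel)"
  proof (rule nn_integral_cong)
    fix x :: real
    \<comment> \<open>As \<open>c\<close> reads off the coefficient of \<open>b\<close>, moving
      \<open>\<phi>\<close> back by \<open>x *\<^sub>R b\<close> also turns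
      \<open>c \<bullet> \<phi> + x\<close> into \<open>c \<bullet> \<phi>\<close>.\<close>
    have cb: "c \<bullet> b = 1" using b by (simp add: c inner_commute)
    show "(\<integral>\<^sup>+\<phi>. ennreal (?\<rho> \<phi>) * ennreal (?\<eta> (c \<bullet> \<phi> + x)) * F (\<phi> + x *\<^sub>R b) \<partial>lborel) =
      (\<integral>\<^sup>+\<phi>. ennreal (?\<rho> (- (x *\<^sub>R b) + \<phi>)) * ennreal (?\<eta> (c \<bullet> \<phi>)) * F \<phi> \<partial>lborel)"
      by (subst nn_integral_lborel_translate[of _ "- (x *\<^sub>R b)", symmetric])
         (auto simp: inner_simps cb)
  qed
  also have "\<dots> = (\<integral>\<^sup>+x. (\<integral>\<^sup>+\<phi>. ennreal (?\<rho> \<phi>) * F \<phi> * ennreal (?\<eta> (x - c \<bullet> \<phi>)) \<partial>lborel) \<partial>lborel)"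
  proof (intro nn_integral_cong)
    fix x \<phi>
    have "ennreal (?\<rho> (- (x *\<^sub>R b) + \<phi>)) * ennreal (?\<eta> (c \<bullet> \<phi>)) = ennreal (?\<rho> \<phi>) * ennreal (?\<eta> (x - c \<bullet> \<phi>))"
      by (simp only: ennreal_mult[symmetric] \<rho>0 normal_density_nonneg exch)
    then show "ennreal (?\<rho> (- (x *\<^sub>R b) + \<phi>)) * ennreal (?\<eta> (c \<bullet> \<phi>)) * F \<phi> =
        ennreal (?\<rho> \<phi>) * F \<phi> * ennreal (?\<eta> (x - c \<bullet> \<phi>))"
      by (simp only: ac_simps)
  qed
  also have "\<dots> = (\<integral>\<^sup>+\<phi>. (\<integral>\<^sup>+x. ennreal (?\<rho> \<phi>) * F \<phi> * ennreal (?\<eta> (x - c \<bullet> \<phi>)) \<partial>lborel) \<partial>lborel)"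
    by (rule lborel_pair.Fubini') measurable
  also have "\<dots> = (\<integral>\<^sup>+\<phi>. ennreal (?\<rho> \<phi>) * F \<phi> \<partial>lborel)"
  proof (rule nn_integral_cong)
    fix \<phi>
    have "(\<integral>\<^sup>+x. ennreal (?\<eta> (x - c \<bullet> \<phi>)) \<partial>lborel) = (\<integral>\<^sup>+x. ennreal (?\<eta> x) \<partial>lborel)"
      by (subst nn_integral_lborel_translate[of _ "- (c \<bullet> \<phi>)", symmetric]) auto
    also have "\<dots> = 1" by (subst nn_integral_eq_integral) auto
    finally show "(\<integral>\<^sup>+x. ennreal (?\<rho> \<phi>) * F \<phi> * ennreal (?\<eta> (x - c \<bullet> \<phi>)) \<partial>lborel) = ennreal (?\<rho> \<phi>) * F \<phi>"
      by (simp add: nn_integral_cmult)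
  qed
  also have "\<dots> = (\<integral>\<^sup>+\<phi>. F \<phi> \<partial>gaussian_vec S)"
    by (rule nn_integral_gaussian_vec[symmetric]) measurable
  finally show ?thesis .
qed

section \<open>Gram matrices and residual sums of squares\<close>

lemma outer_mult_vec: "outer v *v w = (v \<bullet> w) *\<^sub>R v"
  by (simp add: outer_def matrix_vector_mult_def vec_eq_iff inner_vec_def sum_distrib_left sum_distrib_right ac_simps)

lemma sum_outer_mult_vec:
  "(\<Sum>i\<in>I. outer (\<phi> i)) *v w = (\<Sum>i\<in>I. (\<phi> i \<bullet> w) *\<^sub>R \<phi> i)"
  by (induction I rule: infinite_finite_induct) (simp_all add: matrix_vector_mult_add_rdistrib outer_mult_vec)

lemma inner_sum_outer_mult_vec:
  "u \<bullet> ((\<Sum>i\<in>I. outer (\<phi> i)) *v w) = (\<Sum>i\<in>I. (\<phi> i \<bullet> u) * (\<phi> i \<bullet> w))"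
  by (simp add: sum_outer_mult_vec inner_sum_right inner_commute mult.commute)

lemma transpose_sum_outer: "transpose (\<Sum>i\<in>I. outer (\<phi> i)) = (\<Sum>i\<in>I. outer (\<phi> i))"
  by (simp add: transpose_def vec_eq_iff outer_def mult.commute)

lemma invertible_iff_ker:
  fixes A :: "real^'n^'n"
  shows "invertible A \<longleftrightarrow> (\<forall>x. A *v x = 0 \<longrightarrow> x = 0)"
  unfolding invertible_left_inverse matrix_left_invertible_ker ..

lemma sym_pos_def_mat_sum_outer:
  fixes \<phi> :: "'i \<Rightarrow> real^'m"
  assumes "finite I" and inv: "invertible (\<Sum>i\<in>I. outer (\<phi> i))"
  shows "sym_pos_def_mat (\<Sum>i\<in>I. outer (\<phi> i))"
  unfolding sym_pos_def_mat_def
proof (intro conjI allI impI)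
  show "transpose (\<Sum>i\<in>I. outer (\<phi> i)) = (\<Sum>i\<in>I. outer (\<phi> i))"
    by (rule transpose_sum_outer)
  fix x :: "real^'m" assume "x \<noteq> 0"
  show "0 < x \<bullet> ((\<Sum>i\<in>I. outer (\<phi> i)) *v x)"
  proof (rule ccontr)
    assume "\<not> ?thesis"
    then have "(\<Sum>i\<in>I. (\<phi> i \<bullet> x) * (\<phi> i \<bullet> x)) = 0"
      using sum_nonneg[of I "\<lambda>i. (\<phi> i \<bullet> x) * (\<phi> i \<bullet> x)"] by (simp add: inner_sum_outer_mult_vec)
    then have "\<forall>i\<in>I. (\<phi> i \<bullet> x) * (\<phi> i \<bullet> x) = 0"
      by (subst (asm) sum_nonneg_eq_0_iff) (auto simp: assms(1))
    then have "(\<Sum>i\<in>I. outer (\<phi> i)) *v x = 0"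
      by (simp add: sum_outer_mult_vec)
    with inv \<open>x \<noteq> 0\<close> show False by (simp add: invertible_iff_ker)
  qed
qed

text \<open>The quadratic form of a Gram matrix at \<open>w\<close> is the sum of the squares of
  \<open>\<phi> i \<bullet> w\<close>, so its kernel is the common orthogonal complement of the
  rows. The right-hand side is full column rank.\<close>

lemma invertible_sum_outer_iff:
  assumes "finite I"
  shows "invertible (\<Sum>i\<in>I. outer (\<phi> i)) \<longleftrightarrow> (\<forall>w. (\<forall>i\<in>I. \<phi> i \<bullet> w = 0) \<longrightarrow> w = 0)"
proof
  assume inv: "invertible (\<Sum>i\<in>I. outer (\<phi> i))"
  show "\<forall>w. (\<forall>i\<in>I. \<phi> i \<bullet> w = 0) \<longrightarrow> w = 0"
  proof (intro allI impI)
    fix w assume "\<forall>i\<in>I. \<phi> i \<bullet> w = 0"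
    then have "(\<Sum>i\<in>I. outer (\<phi> i)) *v w = 0" by (simp add: sum_outer_mult_vec)
    with inv show "w = 0" by (simp add: invertible_iff_ker)
  qed
next
  assume *: "\<forall>w. (\<forall>i\<in>I. \<phi> i \<bullet> w = 0) \<longrightarrow> w = 0"
  show "invertible (\<Sum>i\<in>I. outer (\<phi> i))"
    unfolding invertible_iff_ker
  proof (intro allI impI)
    fix w assume "(\<Sum>i\<in>I. outer (\<phi> i)) *v w = 0"
    then have "(\<Sum>i\<in>I. (\<phi> i \<bullet> w) * (\<phi> i \<bullet> w)) = 0"
      using inner_sum_outer_mult_vec[of w \<phi> I w] by simp
    then have "\<forall>i\<in>I. (\<phi> i \<bullet> w) * (\<phi> i \<bullet> w) = 0"
      by (subst (asm) sum_nonneg_eq_0_iff) (auto simp: assms)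
    with * show "w = 0" by simp
  qed
qed

text \<open>One fixed realisation \<open>\<phi>\<close> of the training features; the randomness
  left is in the new \<open>b\<close>-components \<open>x\<close>. The vector \<open>c\<close> is
  the functional reading off the \<open>b\<close>-component, so \<open>\<psi>\<close> below is the
  oblique projection along \<open>b\<close> onto the hyperplane orthogonal to
  \<open>c\<close>.\<close>

locale residual_split =
  fixes I :: "'i set" and b c :: "real^'m" and \<phi> :: "'i \<Rightarrow> real^'m"
  assumes finite_I: "finite I" and cb: "c \<bullet> b = 1"
    and inv_W: "invertible (\<Sum>i\<in>I. outer (\<phi> i))"
begin

definition \<psi> :: "'i \<Rightarrow> real^'m" where "\<psi> i = \<phi> i - (c \<bullet> \<phi> i) *\<^sub>R b"

text \<open>The Gram matrix of the \<open>\<psi> i\<close> is singular, as all of them are orthogonal to \<open>c\<close>; the term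
  \<^term>\<open>outer c\<close> makes it invertible without changing its action on their span.\<close>
definition K :: "real^'m^'m" where "K = (\<Sum>i\<in>I. outer (\<psi> i)) + outer c"

text \<open>The right-hand side of the normal equations for regressing \<open>x\<close> on the rows
  \<open>\<psi> i\<close>.\<close>

definition h :: "('i \<Rightarrow> real) \<Rightarrow> real^'m" where "h x = (\<Sum>i\<in>I. x i *\<^sub>R \<psi> i)"

text \<open>The residual sum of squares of the regression of \<open>x\<close> on the \<open>\<psi> i\<close>.\<close>
definition D :: "('i \<Rightarrow> real) \<Rightarrow> real" where
  "D x = (\<Sum>i\<in>I. (x i)\<^sup>2) - h x \<bullet> (matrix_inv K *v h x)"

lemma c_psi: "c \<bullet> \<psi> i = 0" "\<psi> i \<bullet> c = 0"
  using cb by (simp_all add: \<psi>_def inner_diff_right inner_diff_left inner_commute)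

lemma c_nz: "c \<noteq> 0" using cb by auto

lemma K_mult: "K *v w = (\<Sum>i\<in>I. (\<psi> i \<bullet> w) *\<^sub>R \<psi> i) + (c \<bullet> w) *\<^sub>R c"
  by (simp add: K_def matrix_vector_mult_add_rdistrib sum_outer_mult_vec outer_mult_vec)

lemma inner_K: "u \<bullet> (K *v w) = (\<Sum>i\<in>I. (\<psi> i \<bullet> u) * (\<psi> i \<bullet> w)) + (c \<bullet> u) * (c \<bullet> w)"
  by (simp add: K_mult inner_add_right inner_sum_right inner_commute mult.commute)

text \<open>If the form vanishes at \<open>w\<close>, then \<open>c\<close> and all
  \<open>\<psi> i\<close> are orthogonal to \<open>w\<close>, and hence all \<open>\<phi> i\<close>
  to \<open>w - (b \<bullet> w) *\<^sub>R c\<close>. Full rank makes this vector zero, and pairing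
  with \<open>c\<close> forces \<open>b \<bullet> w = 0\<close>, so \<open>w\<close> is
  zero.\<close>

lemma sym_pos_def_K: "sym_pos_def_mat K"
  unfolding sym_pos_def_mat_def
proof (intro conjI allI impI)
  show "transpose K = K"
    by (simp add: K_def transpose_def vec_eq_iff outer_def mult.commute)
  fix w :: "real^'m" assume "w \<noteq> 0"
  show "0 < w \<bullet> (K *v w)"
  proof (rule ccontr)
    assume "\<not> ?thesis"
    then have le: "(\<Sum>i\<in>I. (\<psi> i \<bullet> w) * (\<psi> i \<bullet> w)) + (c \<bullet> w) * (c \<bullet> w) \<le> 0" by (simp add: inner_K)
    have "0 \<le> (\<Sum>i\<in>I. (\<psi> i \<bullet> w) * (\<psi> i \<bullet> w))" "0 \<le> (c \<bullet> w) * (c \<bullet> w)"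
      by (auto intro: sum_nonneg)
    with le have "(\<Sum>i\<in>I. (\<psi> i \<bullet> w) * (\<psi> i \<bullet> w)) = 0" and "(c \<bullet> w) * (c \<bullet> w) = 0" by linarith+
    then have cw: "c \<bullet> w = 0" and "\<forall>i\<in>I. (\<psi> i \<bullet> w) * (\<psi> i \<bullet> w) = 0"
      by (simp, subst (asm) sum_nonneg_eq_0_iff) (auto simp: finite_I)
    then have "\<forall>i\<in>I. \<phi> i \<bullet> (w - (b \<bullet> w) *\<^sub>R c) = 0"
      by (auto simp: \<psi>_def inner_diff_left inner_diff_right inner_commute mult.commute)
    then have w: "w - (b \<bullet> w) *\<^sub>R c = 0"
      using inv_W[unfolded invertible_sum_outer_iff[OF finite_I]] by blast
    then have "c \<bullet> w = (b \<bullet> w) * (c \<bullet> c)" by (metis eq_iff_diff_eq_0 inner_scaleR_right)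
    with cw c_nz have "b \<bullet> w = 0" by simp
    with w \<open>w \<noteq> 0\<close> show False by simp
  qed
qed

lemma invertible_K: "invertible K"
  by (rule sym_pos_def_mat_invertible[OF sym_pos_def_K])

text \<open>The added term makes \<open>c\<close> an eigenvector of \<open>K\<close> with eigenvalue
  \<open>c \<bullet> c\<close>, decoupled from the span of the \<open>\<psi> i\<close>.\<close>

lemma K_inv_c: "matrix_inv K *v c = c /\<^sub>R (c \<bullet> c)"
proof -
  have "K *v (c /\<^sub>R (c \<bullet> c)) = c"
    using c_nz by (simp add: K_mult c_psi)
  then show ?thesis by (metis matrix_inv_mult_vec(1) invertible_K)
qed

lemma resampled_row: "\<phi> i + (t - c \<bullet> \<phi> i) *\<^sub>R b = \<psi> i + t *\<^sub>R b"
  by (simp add: \<psi>_def algebra_simps)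

text \<open>A Schur complement identity. It suffices to exhibit \<open>u\<close> with
  \<open>?V *v u = D x *\<^sub>R b\<close> and \<open>b \<bullet> u = 1\<close>: applying the
  inverse of \<open>?V\<close> and pairing with \<open>b\<close> gives the value, and
  \<open>u \<bullet> (?V *v u) = D x\<close> gives positivity.\<close>

lemma inner_inv_resampled:
  assumes inv: "invertible (\<Sum>i\<in>I. outer (\<phi> i + (x i - c \<bullet> \<phi> i) *\<^sub>R b))"
  shows "0 < D x" "b \<bullet> (matrix_inv (\<Sum>i\<in>I. outer (\<phi> i + (x i - c \<bullet> \<phi> i) *\<^sub>R b)) *v b) = 1 / D x"
proof -
  let ?V = "\<Sum>i\<in>I. outer (\<phi> i + (x i - c \<bullet> \<phi> i) *\<^sub>R b)"
  define w where "w = matrix_inv K *v h x"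
  have Kw: "K *v w = h x" by (simp add: w_def matrix_inv_mult_vec invertible_K)
  have "c \<bullet> h x = 0" by (simp add: h_def inner_sum_right c_psi)
  moreover have "transpose (matrix_inv K) = matrix_inv K"
    using sym_pos_def_mat_matrix_inv[OF sym_pos_def_K] by (simp add: sym_pos_def_mat_def)
  ultimately have cw: "c \<bullet> w = 0"
    unfolding w_def by (simp add: inner_matrix_symm K_inv_c)
  have W0w: "(\<Sum>i\<in>I. (\<psi> i \<bullet> w) *\<^sub>R \<psi> i) = h x"
    using Kw by (simp add: K_mult cw)
  \<comment> \<open>Here \<open>w\<close> holds the regression coefficients. Subtracting it makes
    the rows of the resampled matrix, paired with \<open>u\<close>, equal to the residuals; the
    multiple of \<open>c\<close> is invisible to every \<open>\<psi> i\<close> and is chosen to make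
    \<open>b \<bullet> u = 1\<close>.\<close>
  define u where "u = (1 + b \<bullet> w) *\<^sub>R c - w"
  have bu: "b \<bullet> u = 1" using cb by (simp add: u_def inner_diff_right inner_commute)
  have row: "(\<psi> i + x i *\<^sub>R b) \<bullet> u = x i - \<psi> i \<bullet> w" for i
    using bu by (simp add: inner_add_left) (simp add: u_def inner_diff_right c_psi)
  have Dx: "D x = (\<Sum>i\<in>I. (x i - \<psi> i \<bullet> w) * x i)"
  proof -
    have "h x \<bullet> w = (\<Sum>i\<in>I. (\<psi> i \<bullet> w) * x i)"
      by (simp add: h_def inner_sum_left mult.commute)
    then show ?thesis
      by (simp add: D_def w_def[symmetric] left_diff_distrib sum_subtractf power2_eq_square)
  qed
  have Vu: "?V *v u = D x *\<^sub>R b"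
  proof -
    have "?V *v u = (\<Sum>i\<in>I. (x i - \<psi> i \<bullet> w) *\<^sub>R (\<psi> i + x i *\<^sub>R b))"
      by (simp add: sum_outer_mult_vec resampled_row row)
    also have "\<dots> = (\<Sum>i\<in>I. (x i - \<psi> i \<bullet> w) *\<^sub>R \<psi> i) + (\<Sum>i\<in>I. (x i - \<psi> i \<bullet> w) * x i) *\<^sub>R b"
      by (simp add: scaleR_add_right sum.distrib scaleR_sum_left)
    \<comment> \<open>The normal equations: residuals are orthogonal to the regressors.\<close>
    also have "(\<Sum>i\<in>I. (x i - \<psi> i \<bullet> w) *\<^sub>R \<psi> i) = 0"
      by (simp add: scaleR_diff_left sum_subtractf W0w h_def[symmetric])
    finally show ?thesis by (simp add: Dx)
  qed
  have "u \<noteq> 0" using bu by auto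
  then have "0 < u \<bullet> (?V *v u)"
    using sym_pos_def_mat_sum_outer[OF finite_I inv] by (simp add: sym_pos_def_mat_def)
  then show pos: "0 < D x" by (simp add: Vu bu inner_commute)
  have "matrix_inv ?V *v (D x *\<^sub>R b) = u"
    unfolding Vu[symmetric] by (rule matrix_inv_mult_vec[OF inv])
  then have "D x *\<^sub>R (matrix_inv ?V *v b) = u" by (simp add: matrix_vector_mult_scaleR)
  from arg_cong[OF this, of "\<lambda>v. b \<bullet> v"] have "D x * (b \<bullet> (matrix_inv ?V *v b)) = 1"
    unfolding bu inner_scaleR_right .
  then show "b \<bullet> (matrix_inv ?V *v b) = 1 / D x" using pos by (simp add: field_simps)
qed

lemma borel_measurable_D [measurable]: "D \<in> borel_measurable (PiM I (\<lambda>_. std_normal))"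
  unfolding D_def[abs_def] h_def by measurable

text \<open>Under covariance \<open>matrix_inv K\<close>, the full form of \<open>K\<close> is the
  sum over the \<open>\<psi> i\<close> plus the square of \<open>c \<bullet> \<xi>\<close>, an
  independent standard normal. The full form contributes \<open>sqrt d ^ CARD('m)\<close>; dividing
  out the \<open>c\<close>-part removes one factor \<open>sqrt d\<close>. This reflects that the
  \<open>\<psi> i\<close> span only m - 1 dimensions.\<close>

lemma nn_integral_exp_W0:
  assumes d: "0 < (d::real)" and s: "s = (1 - 1 / d) / 2"
  shows "(\<integral>\<^sup>+\<xi>. ennreal (exp (s * (\<Sum>i\<in>I. (\<psi> i \<bullet> \<xi>)\<^sup>2))) \<partial>gaussian_vec (matrix_inv K)) =
    ennreal (sqrt d ^ CARD('m) / sqrt d)"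
proof -
  \<comment> \<open>The scaled vector \<open>?b\<close> satisfies \<open>K *v ?b = c\<close> and
    \<open>c \<bullet> ?b = 1\<close>, so the resampling identity applies with \<open>?b\<close> as
    direction and \<open>c\<close> as functional, for the covariance
    \<open>matrix_inv K\<close>.\<close>
  let ?S = "matrix_inv K" and ?b = "c /\<^sub>R (c \<bullet> c)"
  let ?E = "\<integral>\<^sup>+\<xi>. ennreal (exp (s * (\<Sum>i\<in>I. (\<psi> i \<bullet> \<xi>)\<^sup>2))) \<partial>gaussian_vec ?S"
  have S: "sym_pos_def_mat ?S" by (rule sym_pos_def_mat_matrix_inv[OF sym_pos_def_K])
  have inv_inv: "matrix_inv ?S = K" by (rule matrix_inv_eqI[OF matrix_inv_left[OF invertible_K]])
  have Kb: "K *v ?b = c" using c_nz by (simp add: K_mult c_psi)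
  have cb': "c \<bullet> ?b = 1" using c_nz by simp
  have d': "1 + 2 * (- s) = 1 / d" using d by (simp add: s field_simps)
  have "(\<integral>\<^sup>+\<xi>. ennreal (exp (- (- s) * (\<xi> \<bullet> (matrix_inv ?S *v \<xi>)))) \<partial>gaussian_vec ?S) =
      ennreal (1 / sqrt (1 + 2 * (- s)) ^ CARD('m))"
    by (rule nn_integral_gaussian_vec_exp_quadratic[OF S]) (unfold d', simp add: d)
  then have 1: "(\<integral>\<^sup>+\<xi>. ennreal (exp (s * (\<xi> \<bullet> (K *v \<xi>)))) \<partial>gaussian_vec ?S) = ennreal (sqrt d ^ CARD('m))"
    unfolding d' inv_inv by (simp add: real_sqrt_divide power_divide)
  have quad: "(\<xi> + (x - c \<bullet> \<xi>) *\<^sub>R ?b) \<bullet> (K *v (\<xi> + (x - c \<bullet> \<xi>) *\<^sub>R ?b)) = (\<Sum>i\<in>I. (\<psi> i \<bullet> \<xi>)\<^sup>2) + x\<^sup>2" for \<xi> x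
  proof -
    have "\<psi> i \<bullet> (\<xi> + (x - c \<bullet> \<xi>) *\<^sub>R ?b) = \<psi> i \<bullet> \<xi>" for i by (simp add: inner_add_right c_psi)
    moreover have "c \<bullet> (\<xi> + (x - c \<bullet> \<xi>) *\<^sub>R ?b) = x" by (simp only: inner_add_right inner_scaleR_right[of _ _ ?b] cb') simp
    ultimately show ?thesis by (simp only: inner_K power2_eq_square)
  qed
  have "(\<integral>\<^sup>+\<xi>. ennreal (exp (s * (\<xi> \<bullet> (K *v \<xi>)))) \<partial>gaussian_vec ?S) =
     (\<integral>\<^sup>+\<xi>. (\<integral>\<^sup>+x. ennreal (exp (s * ((\<xi> + (x - c \<bullet> \<xi>) *\<^sub>R ?b) \<bullet> (K *v (\<xi> + (x - c \<bullet> \<xi>) *\<^sub>R ?b))))) \<partial>std_normal) \<partial>gaussian_vec ?S)"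
    by (rule nn_integral_gaussian_vec_resample[OF S, symmetric])
       (simp_all only: inv_inv Kb inner_commute[of ?b] cb', measurable)
  also have "\<dots> = (\<integral>\<^sup>+\<xi>. (\<integral>\<^sup>+x. ennreal (exp (s * (\<Sum>i\<in>I. (\<psi> i \<bullet> \<xi>)\<^sup>2))) * ennreal (exp (- (- s) * x\<^sup>2 + 0 * x)) \<partial>std_normal) \<partial>gaussian_vec ?S)"
    by (simp only: quad) (simp add: ennreal_mult[symmetric] exp_add[symmetric] distrib_left)
  also have "\<dots> = (\<integral>\<^sup>+\<xi>. ennreal (exp (s * (\<Sum>i\<in>I. (\<psi> i \<bullet> \<xi>)\<^sup>2))) * ennreal (sqrt d) \<partial>gaussian_vec ?S)"
  proof (rule nn_integral_cong)
    fix \<xi>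
    have "(\<integral>\<^sup>+x. ennreal (exp (- (- s) * x\<^sup>2 + 0 * x)) \<partial>std_normal) = ennreal (sqrt d)"
      by (subst nn_integral_std_normal_exp) (simp_all only: d', simp_all add: d real_sqrt_divide)
    then show "(\<integral>\<^sup>+x. ennreal (exp (s * (\<Sum>i\<in>I. (\<psi> i \<bullet> \<xi>)\<^sup>2))) * ennreal (exp (- (- s) * x\<^sup>2 + 0 * x)) \<partial>std_normal) =
        ennreal (exp (s * (\<Sum>i\<in>I. (\<psi> i \<bullet> \<xi>)\<^sup>2))) * ennreal (sqrt d)"
      by (subst nn_integral_cmult) simp_all
  qed
  also have "\<dots> = ?E * ennreal (sqrt d)"
    by (rule nn_integral_multc) measurable
  finally have "?E * ennreal (sqrt d) = ennreal (sqrt d ^ CARD('m))" using 1 by simp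
  then have "?E * (ennreal (sqrt d) * ennreal (1 / sqrt d)) = ennreal (sqrt d ^ CARD('m)) * ennreal (1 / sqrt d)"
    by (simp only: mult.assoc[symmetric])
  then show ?thesis using d by (simp add: ennreal_mult[symmetric])
qed

text \<open>Writing \<open>exp (t h \<bullet> K\<^sup>-\<^sup>1 h)\<close> as a Gaussian expectation over an auxiliary vector \<open>\<xi>\<close> makes the
  integral over \<open>x\<close> factorise.\<close>
lemma nn_integral_exp_D:
  assumes t: "0 \<le> t"
  shows "(\<integral>\<^sup>+x. ennreal (exp (- t * D x)) \<partial>PiM I (\<lambda>_. std_normal)) =
    ennreal (sqrt (1 + 2 * t) ^ CARD('m) / sqrt (1 + 2 * t) ^ Suc (card I))"
proof -
  let ?S = "matrix_inv K"
  define d where "d = 1 + 2 * t"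
  have d: "0 < d" and dt: "0 < 1 + 2 * t" using t by (simp_all add: d_def)
  have S: "sym_pos_def_mat ?S" by (rule sym_pos_def_mat_matrix_inv[OF sym_pos_def_K])
  interpret G: prob_space "gaussian_vec ?S" by (rule prob_space_gaussian_vec[OF S])
  interpret N: prob_space "PiM I (\<lambda>_. std_normal)" by (intro prob_space_PiM prob_space_std_normal)
  interpret GN: pair_sigma_finite "gaussian_vec ?S" "PiM I (\<lambda>_. std_normal)" ..
  let ?f = "\<lambda>\<xi> x. ennreal (exp (- t * (\<Sum>i\<in>I. (x i)\<^sup>2) + (\<Sum>i\<in>I. (sqrt (2 * t) * (\<psi> i \<bullet> \<xi>)) * x i)))"
  have "ennreal (exp (- t * D x)) = (\<integral>\<^sup>+\<xi>. ?f \<xi> x \<partial>gaussian_vec ?S)" for x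
  proof -
    \<comment> \<open>The factor \<open>sqrt (2 * t)\<close> compensates the 1/2 in the exponent of
      the moment generating function, leaving \<open>t\<close> times the quadratic form.\<close>
    let ?h = "sqrt (2 * t) *\<^sub>R h x"
    have "- t * D x = - t * (\<Sum>i\<in>I. (x i)\<^sup>2) + (?h \<bullet> (?S *v ?h)) / 2"
      using t by (simp add: D_def matrix_vector_mult_scaleR algebra_simps)
    then have "ennreal (exp (- t * D x)) =
        ennreal (exp (- t * (\<Sum>i\<in>I. (x i)\<^sup>2))) * ennreal (exp ((?h \<bullet> (?S *v ?h)) / 2))"
      by (simp only: exp_add ennreal_mult[symmetric] exp_ge_zero)
    also have "\<dots> = (\<integral>\<^sup>+\<xi>. ennreal (exp (- t * (\<Sum>i\<in>I. (x i)\<^sup>2))) * ennreal (exp (?h \<bullet> \<xi>)) \<partial>gaussian_vec ?S)"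
      by (subst nn_integral_cmult) (simp_all only: nn_integral_gaussian_vec_exp_inner[OF S], measurable)
    also have "\<dots> = (\<integral>\<^sup>+\<xi>. ?f \<xi> x \<partial>gaussian_vec ?S)"
    proof (rule nn_integral_cong)
      fix \<xi>
      have "?h \<bullet> \<xi> = (\<Sum>i\<in>I. (sqrt (2 * t) * (\<psi> i \<bullet> \<xi>)) * x i)"
        by (simp add: h_def inner_sum_left sum_distrib_left ac_simps)
      then show "ennreal (exp (- t * (\<Sum>i\<in>I. (x i)\<^sup>2))) * ennreal (exp (?h \<bullet> \<xi>)) = ?f \<xi> x"
        by (simp only: exp_add ennreal_mult[symmetric] exp_ge_zero)
    qed
    finally show ?thesis .
  qed
  then have "(\<integral>\<^sup>+x. ennreal (exp (- t * D x)) \<partial>PiM I (\<lambda>_. std_normal)) =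
      (\<integral>\<^sup>+x. (\<integral>\<^sup>+\<xi>. ?f \<xi> x \<partial>gaussian_vec ?S) \<partial>PiM I (\<lambda>_. std_normal))"
    by (simp only:)
  also have "\<dots> = (\<integral>\<^sup>+\<xi>. (\<integral>\<^sup>+x. ?f \<xi> x \<partial>PiM I (\<lambda>_. std_normal)) \<partial>gaussian_vec ?S)"
    by (rule GN.Fubini') measurable
  \<comment> \<open>Each coordinate of \<open>x\<close> contributes a Gaussian integral with linear
    coefficient \<open>sqrt (2 * t) * (\<psi> i \<bullet> \<xi>)\<close>. As
    \<open>2 * t = d - 1\<close>, the exponents add up with coefficient
    \<open>(d - 1) / (2 * d)\<close>.\<close>
  also have "\<dots> = (\<integral>\<^sup>+\<xi>. ennreal (1 / sqrt d ^ card I) * ennreal (exp ((1 - 1 / d) / 2 * (\<Sum>i\<in>I. (\<psi> i \<bullet> \<xi>)\<^sup>2))) \<partial>gaussian_vec ?S)"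
  proof (rule nn_integral_cong)
    fix \<xi>
    let ?q = "\<Sum>i\<in>I. (\<psi> i \<bullet> \<xi>)\<^sup>2"
    have "(\<Sum>i\<in>I. (sqrt (2 * t) * (\<psi> i \<bullet> \<xi>))\<^sup>2) = 2 * t * ?q"
      using t by (simp add: power_mult_distrib sum_distrib_left)
    moreover have "2 * t * ?q / (2 * d) = (1 - 1 / d) / 2 * ?q"
      using d by (simp add: field_simps d_def)
    moreover have "(\<integral>\<^sup>+x. ?f \<xi> x \<partial>PiM I (\<lambda>_. std_normal)) =
        ennreal (exp ((\<Sum>i\<in>I. (sqrt (2 * t) * (\<psi> i \<bullet> \<xi>))\<^sup>2) / (2 * d)) / sqrt d ^ card I)"
      unfolding d_def by (rule nn_integral_PiM_std_normal_exp[OF dt finite_I])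
    ultimately have "(\<integral>\<^sup>+x. ?f \<xi> x \<partial>PiM I (\<lambda>_. std_normal)) = ennreal (exp ((1 - 1 / d) / 2 * ?q) / sqrt d ^ card I)"
      by (simp only:)
    also have "\<dots> = ennreal (1 / sqrt d ^ card I) * ennreal (exp ((1 - 1 / d) / 2 * ?q))"
      using d by (subst ennreal_mult[symmetric]) auto
    finally show "(\<integral>\<^sup>+x. ?f \<xi> x \<partial>PiM I (\<lambda>_. std_normal)) =
        ennreal (1 / sqrt d ^ card I) * ennreal (exp ((1 - 1 / d) / 2 * ?q))" .
  qed
  also have "\<dots> = ennreal (1 / sqrt d ^ card I) * ennreal (sqrt d ^ CARD('m) / sqrt d)"
    by (subst nn_integral_cmult) (simp_all only: nn_integral_exp_W0[OF d refl], measurable)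
  \<comment> \<open>The total power of \<open>d\<close> is -(n - m + 1) / 2 with n =
    \<open>card I\<close>: n observations minus m - 1 fitted dimensions.\<close>
  also have "\<dots> = ennreal (sqrt d ^ CARD('m) / sqrt d ^ Suc (card I))"
    using d by (subst ennreal_mult[symmetric]) (auto simp: field_simps)
  finally show ?thesis unfolding d_def .
qed

end

section \<open>Inverse moments of Gaussian Gram matrices\<close>

text \<open>Inverse powers as mixtures of exponentials: after Tonelli, inverse moments of a positive
  variable need only its Laplace transform.\<close>

lemma nn_integral_exp_Laplace:
  assumes "0 < (x::real)"
  shows "(\<integral>\<^sup>+t. ennreal (exp (- t * x)) * indicator {0..} t \<partial>lborel) = ennreal (1 / x)"
    and "(\<integral>\<^sup>+t. ennreal (t * exp (- t * x)) * indicator {0..} t \<partial>lborel) = ennreal (1 / x\<^sup>2)"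
proof -
  have "(\<integral>\<^sup>+t. ennreal (exp (- t * x)) * indicator {0..} t \<partial>lborel) = ennreal (0 - (- exp (- 0 * x) / x))"
  proof (rule nn_integral_FTC_atLeast)
    show "((\<lambda>t. - exp (- t * x) / x) \<longlongrightarrow> 0) at_top" using assms by real_asymp
    show "((\<lambda>t. - exp (- t * x) / x) has_real_derivative exp (- t * x)) (at t)" for t
      using assms by (auto intro!: derivative_eq_intros)
  qed auto
  then show "(\<integral>\<^sup>+t. ennreal (exp (- t * x)) * indicator {0..} t \<partial>lborel) = ennreal (1 / x)" by simp
  have "(\<integral>\<^sup>+t. ennreal (t * exp (- t * x)) * indicator {0..} t \<partial>lborel) =
      ennreal (0 - (- (0 / x + 1 / x\<^sup>2) * exp (- 0 * x)))"
  proof (rule nn_integral_FTC_atLeast)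
    show "((\<lambda>t. - (t / x + 1 / x\<^sup>2) * exp (- t * x)) \<longlongrightarrow> 0) at_top" using assms by real_asymp
    show "((\<lambda>t. - (t / x + 1 / x\<^sup>2) * exp (- t * x)) has_real_derivative t * exp (- t * x)) (at t)" for t
      using assms by (auto intro!: derivative_eq_intros simp: field_simps power2_eq_square)
  qed auto
  then show "(\<integral>\<^sup>+t. ennreal (t * exp (- t * x)) * indicator {0..} t \<partial>lborel) = ennreal (1 / x\<^sup>2)" by simp
qed

text \<open>These are the first two inverse moments of a chi-squared variable with \<open>k\<close>
  degrees of freedom; \<open>4 < k\<close> makes the antiderivatives vanish at infinity.\<close>

lemma nn_integral_powr_Laplace:
  fixes k :: real
  assumes "4 < k"
  shows "(\<integral>\<^sup>+t. ennreal ((1 + 2 * t) powr (- k / 2)) * indicator {0..} t \<partial>lborel) = ennreal (1 / (k - 2))"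
    and "(\<integral>\<^sup>+t. ennreal (t * (1 + 2 * t) powr (- k / 2)) * indicator {0..} t \<partial>lborel) =
      ennreal (1 / ((k - 2) * (k - 4)))"
proof -
  have "(\<integral>\<^sup>+t. ennreal ((1 + 2 * t) powr (- k / 2)) * indicator {0..} t \<partial>lborel) =
      ennreal (0 - (- ((1 + 2 * 0) powr (1 - k / 2)) / (k - 2)))"
  proof (rule nn_integral_FTC_atLeast)
    show "((\<lambda>t. - ((1 + 2 * t) powr (1 - k / 2)) / (k - 2)) \<longlongrightarrow> 0) at_top" using assms by real_asymp
    show "((\<lambda>t. - ((1 + 2 * t) powr (1 - k / 2)) / (k - 2)) has_real_derivative (1 + 2 * t) powr (- k / 2)) (at t)"
      if "0 \<le> t" for t
    proof -
      have "((\<lambda>t. - ((1 + 2 * t) powr (1 - k / 2)) / (k - 2)) has_real_derivative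
          - ((1 - k / 2) * (1 + 2 * t) powr (1 - k / 2 - 1) * 2) / (k - 2)) (at t)"
        using that assms by (auto intro!: derivative_eq_intros)
      moreover have "- ((1 - k / 2) * (1 + 2 * t) powr (1 - k / 2 - 1) * 2) / (k - 2) = (1 + 2 * t) powr (- k / 2)"
        using assms by (simp add: field_simps)
      ultimately show ?thesis by simp
    qed
  qed auto
  then show "(\<integral>\<^sup>+t. ennreal ((1 + 2 * t) powr (- k / 2)) * indicator {0..} t \<partial>lborel) = ennreal (1 / (k - 2))"
    by simp
  \<comment> \<open>Writing \<open>t\<close> as half of \<open>(1 + 2 * t) - 1\<close> splits the
    integrand into two pure powers; \<open>?F\<close> is the sum of their antiderivatives.\<close>
  let ?F = "\<lambda>t. (1 + 2 * t) powr (1 - k / 2) / (2 * (k - 2)) - (1 + 2 * t) powr (2 - k / 2) / (2 * (k - 4))"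
  have "(\<integral>\<^sup>+t. ennreal (t * (1 + 2 * t) powr (- k / 2)) * indicator {0..} t \<partial>lborel) = ennreal (0 - ?F 0)"
  proof (rule nn_integral_FTC_atLeast)
    show "(?F \<longlongrightarrow> 0) at_top" using assms by real_asymp
    show "(?F has_real_derivative t * (1 + 2 * t) powr (- k / 2)) (at t)" if "0 \<le> t" for t
    proof -
      let ?d = "1 + 2 * t"
      have d: "0 < ?d" using that by simp
      have "(?F has_real_derivative ((1 - k / 2) * ?d powr (1 - k / 2 - 1) * 2 / (2 * (k - 2)) -
          (2 - k / 2) * ?d powr (2 - k / 2 - 1) * 2 / (2 * (k - 4)))) (at t)"
        using d assms by (auto intro!: derivative_eq_intros)
      moreover have "(1 - k / 2) * ?d powr (1 - k / 2 - 1) * 2 / (2 * (k - 2)) -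
          (2 - k / 2) * ?d powr (2 - k / 2 - 1) * 2 / (2 * (k - 4)) = t * ?d powr (- k / 2)"
      proof -
        have 1: "(1 - k / 2) * ?d powr (1 - k / 2 - 1) * 2 / (2 * (k - 2)) = - (?d powr (- k / 2)) / 2"
          using assms by (simp add: field_simps)
        have 2: "(2 - k / 2) * ?d powr (2 - k / 2 - 1) * 2 / (2 * (k - 4)) = - (?d powr (1 - k / 2)) / 2"
          using assms by (simp add: field_simps)
        have 3: "?d powr (1 - k / 2) = ?d * ?d powr (- k / 2)"
          using d powr_add[of ?d 1 "- k / 2"] by simp
        show ?thesis unfolding 1 2 3 by (simp add: field_simps)
      qed
      ultimately show ?thesis by (simp only:)
    qed
  qed auto
  moreover have "0 - ?F 0 = 1 / ((k - 2) * (k - 4))"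
  proof -
    have nz: "k - 2 \<noteq> 0" "k - 4 \<noteq> 0" using assms by auto
    have "0 - ?F 0 = 1 / (2 * (k - 4)) - 1 / (2 * (k - 2))" by simp
    also have "\<dots> = 1 / ((k - 2) * (k - 4))" using nz by (simp add: divide_simps) (simp add: algebra_simps)
    finally show ?thesis .
  qed
  ultimately show "(\<integral>\<^sup>+t. ennreal (t * (1 + 2 * t) powr (- k / 2)) * indicator {0..} t \<partial>lborel) =
      ennreal (1 / ((k - 2) * (k - 4)))"
    by (simp only:)
qed

text \<open>On rectangles the double integral factorises over the sample index and reduces to
  resampling a single vector. An equality of measures is wanted because it transports almost sure
  invertibility as well as integrals.\<close>

lemma distr_PiM_gaussian_vec_resample:
  fixes S :: "real^'m^'m" and I :: "'i set"
  assumes S: "sym_pos_def_mat S" and b: "b \<bullet> (matrix_inv S *v b) = 1"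
    and c: "c = matrix_inv S *v b" and I: "finite I"
  shows "distr (PiM I (\<lambda>_. gaussian_vec S) \<Otimes>\<^sub>M PiM I (\<lambda>_. std_normal)) (PiM I (\<lambda>_. gaussian_vec S))
      (\<lambda>(\<phi>, x). \<lambda>i\<in>I. \<phi> i + (x i - c \<bullet> \<phi> i) *\<^sub>R b) = PiM I (\<lambda>_. gaussian_vec S)"
proof -
  interpret G: prob_space "gaussian_vec S" by (rule prob_space_gaussian_vec[OF S])
  interpret GP: product_prob_space "\<lambda>_::'i. gaussian_vec S" UNIV ..
  interpret NI: prob_space "PiM I (\<lambda>_. std_normal)" by (intro prob_space_PiM prob_space_std_normal)
  let ?G = "PiM I (\<lambda>_. gaussian_vec S)" and ?N = "PiM I (\<lambda>_. std_normal)"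
  let ?r = "\<lambda>\<phi> (x::real). \<phi> + (x - c \<bullet> \<phi>) *\<^sub>R b"
  let ?T = "\<lambda>(\<phi>, x). \<lambda>i\<in>I. \<phi> i + (x i - c \<bullet> \<phi> i) *\<^sub>R b"
  have T [measurable]: "?T \<in> ?G \<Otimes>\<^sub>M ?N \<rightarrow>\<^sub>M ?G"
    unfolding split_beta' by (rule measurable_restrict) measurable
  show ?thesis
  proof (rule GP.PiM_eqI[OF I])
    show "sets (distr (?G \<Otimes>\<^sub>M ?N) ?G ?T) = sets ?G" by simp
    fix A assume A: "\<And>i. i \<in> I \<Longrightarrow> A i \<in> sets (gaussian_vec S)"
    then have A' [measurable]: "A i \<in> sets borel" if "i \<in> I" for i using that by simp
    have [measurable]: "Pi\<^sub>E I A \<in> sets ?G"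
      using A I by (intro sets_PiM_I_finite) auto
    have "emeasure (distr (?G \<Otimes>\<^sub>M ?N) ?G ?T) (Pi\<^sub>E I A) =
        (\<integral>\<^sup>+\<omega>. indicator (Pi\<^sub>E I A) \<omega> \<partial>distr (?G \<Otimes>\<^sub>M ?N) ?G ?T)"
      by simp
    also have "\<dots> = (\<integral>\<^sup>+\<omega>. indicator (Pi\<^sub>E I A) (?T \<omega>) \<partial>(?G \<Otimes>\<^sub>M ?N))"
      by (rule nn_integral_distr) measurable
    also have "\<dots> = (\<integral>\<^sup>+\<phi>. (\<integral>\<^sup>+x. indicator (Pi\<^sub>E I A) (?T (\<phi>, x)) \<partial>?N) \<partial>?G)"
      by (rule NI.nn_integral_fst[symmetric]) measurable
    also have "\<dots> = (\<integral>\<^sup>+\<phi>. (\<integral>\<^sup>+x. (\<Prod>i\<in>I. indicator (A i) (?r (\<phi> i) (x i))) \<partial>?N) \<partial>?G)"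
    proof -
      have "indicator (Pi\<^sub>E I A) (restrict g I) = (\<Prod>i\<in>I. indicator (A i) (g i) :: ennreal)" for g
        using I by (auto simp: indicator_def Pi_iff intro!: prod.neutral[symmetric])
      then show ?thesis by simp
    qed
    also have "\<dots> = (\<integral>\<^sup>+\<phi>. (\<Prod>i\<in>I. \<integral>\<^sup>+x. indicator (A i) (?r (\<phi> i) x) \<partial>std_normal) \<partial>?G)"
      by (intro nn_integral_cong std_normals.product_nn_integral_prod I) measurable
    also have "\<dots> = (\<Prod>i\<in>I. \<integral>\<^sup>+\<phi>. (\<integral>\<^sup>+x. indicator (A i) (?r \<phi> x) \<partial>std_normal) \<partial>gaussian_vec S)"
      by (intro GP.product_nn_integral_prod I) measurable
    also have "\<dots> = (\<Prod>i\<in>I. emeasure (gaussian_vec S) (A i))"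
    proof (rule prod.cong[OF refl])
      fix i assume i: "i \<in> I"
      have "(\<integral>\<^sup>+\<phi>. (\<integral>\<^sup>+x. indicator (A i) (?r \<phi> x) \<partial>std_normal) \<partial>gaussian_vec S) =
          (\<integral>\<^sup>+\<phi>. indicator (A i) \<phi> \<partial>gaussian_vec S)"
        by (rule nn_integral_gaussian_vec_resample[OF S b c]) (use A'[OF i] in measurable)
      then show "(\<integral>\<^sup>+\<phi>. (\<integral>\<^sup>+x. indicator (A i) (?r \<phi> x) \<partial>std_normal) \<partial>gaussian_vec S) =
          emeasure (gaussian_vec S) (A i)"
        using A'[OF i] by simp
    qed
    finally show "emeasure (distr (?G \<Otimes>\<^sub>M ?N) ?G ?T) (Pi\<^sub>E I A) = (\<Prod>i\<in>I. emeasure (gaussian_vec S) (A i))" .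
  qed
qed

section \<open>Almost sure invertibility of the Gram matrix\<close>

lemma AE_gaussian_vec_inner_nonzero:
  assumes "a \<noteq> 0"
  shows "AE x in gaussian_vec S. a \<bullet> x \<noteq> 0"
proof -
  have "{x. a \<bullet> x = 0} \<in> null_sets lebesgue"
    using negligible_hyperplane[of a 0] assms by (simp add: negligible_iff_null_sets)
  moreover have "{x. a \<bullet> x = 0} \<in> sets borel"
    by (intro borel_closed closed_hyperplane)
  ultimately have "{x. a \<bullet> x = 0} \<in> null_sets lborel"
    by (auto simp: null_sets_def emeasure_completion)
  then have "AE x in lborel. a \<bullet> x \<noteq> 0"
    by (rule AE_I') auto
  then show ?thesis
    unfolding gaussian_vec_def by (subst AE_density) auto
qed

text \<open>The determinant is linear in one row; the representing vector \<open>a\<close> is the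
  vector of cofactors, obtained through the adjoint.\<close>

lemma det_row_linear:
  fixes R :: "'m::finite \<Rightarrow> real^'m"
  shows "\<exists>a. \<forall>y. det (\<chi> i. if i = j then y else R i) = a \<bullet> y"
proof -
  let ?f = "\<lambda>y. det (\<chi> i. if i = j then y else R i)"
  have "linear ?f"
  proof (rule linearI)
    show "?f (x + y) = ?f x + ?f y" for x y
      using det_row_add[of j "\<lambda>_. x" "\<lambda>_. y" R] by simp
    show "?f (r *\<^sub>R x) = r *\<^sub>R ?f x" for r x
    proof -
      have "r *s x = r *\<^sub>R x" by (simp add: vec_eq_iff)
      then show ?thesis using det_row_mul[of j r "\<lambda>_. x" R] by (simp only: real_scaleR_def)
    qed
  qed
  then have "?f y = adjoint ?f 1 \<bullet> y" for y
    using adjoint_works[of ?f y 1] by (simp add: inner_commute)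
  then show ?thesis by blast
qed

text \<open>Induction on \<open>J\<close>: the determinant is linear in the row that becomes random, so it vanishes only
  when this row lies in a hyperplane.\<close>
lemma AE_PiM_gaussian_vec_det_nonzero:
  fixes S :: "real^'m^'m" and J :: "'m set"
  assumes S: "sym_pos_def_mat S" and I: "finite I" and \<iota>: "inj \<iota>" "range \<iota> \<subseteq> I"
  shows "AE \<phi> in PiM I (\<lambda>_. gaussian_vec S). det (\<chi> j. if j \<in> J then \<phi> (\<iota> j) else axis j 1 :: real^'m^'m) \<noteq> 0"
proof -
  interpret G: prob_space "gaussian_vec S" by (rule prob_space_gaussian_vec[OF S])
  interpret GP: product_prob_space "\<lambda>_. gaussian_vec S" UNIV ..
  let ?M = "\<lambda>J \<phi>. (\<chi> j. if j \<in> J then \<phi> (\<iota> j) else axis j 1) :: real^'m^'m"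
  have [measurable]: "?M J \<in> borel_measurable (PiM I (\<lambda>_. gaussian_vec S))" for J
  proof (rule borel_measurable_vecI)
    fix j
    have "\<iota> j \<in> I" using \<iota> by auto
    then show "(\<lambda>\<phi>. ?M J \<phi> $ j) \<in> borel_measurable (PiM I (\<lambda>_. gaussian_vec S))"
      by (cases "j \<in> J") (simp_all, measurable)
  qed
  have "finite J" by simp
  then show ?thesis
  proof (induction J)
    case empty
    have "(\<chi> j. axis j 1) = (mat 1 :: real^'m^'m)"
      by (auto simp: vec_eq_iff axis_def mat_def)
    then show ?case by simp
  next
    case (insert j J)
    define I' where "I' = I - {\<iota> j}"
    have I': "I = insert (\<iota> j) I'" "finite I'" "\<iota> j \<notin> I'"
      using \<iota> I by (auto simp: I'_def)
    \<comment> \<open>The insertion rule for product measures concerns integrals, so null sets are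
      handled as vanishing integrals of indicators.\<close>
    let ?bad = "\<lambda>J \<phi>. indicator {\<phi>. det (?M J \<phi>) = 0} \<phi> :: ennreal"
    have [measurable]: "?bad J \<in> borel_measurable (PiM (insert (\<iota> j) I') (\<lambda>_. gaussian_vec S))" for J
      unfolding I'(1)[symmetric] by measurable
    have split: "(\<integral>\<^sup>+\<phi>. ?bad J \<phi> \<partial>PiM I (\<lambda>_. gaussian_vec S)) =
        (\<integral>\<^sup>+f. (\<integral>\<^sup>+y. ?bad J (f(\<iota> j := y)) \<partial>gaussian_vec S) \<partial>PiM I' (\<lambda>_. gaussian_vec S))" for J
      unfolding I'(1) by (rule GP.product_nn_integral_insert) (use I' in auto)
    have AE_iff: "(AE \<phi> in PiM I (\<lambda>_. gaussian_vec S). det (?M J \<phi>) \<noteq> 0) \<longleftrightarrow>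
        (AE f in PiM I' (\<lambda>_. gaussian_vec S). AE y in gaussian_vec S. det (?M J (f(\<iota> j := y))) \<noteq> 0)" for J
    proof -
      have m1 [measurable]: "(\<lambda>y. ?bad J (f(\<iota> j := y))) \<in> borel_measurable (gaussian_vec S)"
        if "f \<in> space (PiM I' (\<lambda>_. gaussian_vec S))" for f
        by (rule measurable_compose[OF measurable_component_update[OF that I'(3)]]) measurable
      have "(AE \<phi> in PiM I (\<lambda>_. gaussian_vec S). det (?M J \<phi>) \<noteq> 0) \<longleftrightarrow>
          (\<integral>\<^sup>+\<phi>. ?bad J \<phi> \<partial>PiM I (\<lambda>_. gaussian_vec S)) = 0"
        by (subst nn_integral_0_iff_AE) (auto simp: indicator_def)
      also have "\<dots> \<longleftrightarrow> (AE f in PiM I' (\<lambda>_. gaussian_vec S). (\<integral>\<^sup>+y. ?bad J (f(\<iota> j := y)) \<partial>gaussian_vec S) = 0)"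
        unfolding split by (subst nn_integral_0_iff_AE) auto
      also have "\<dots> \<longleftrightarrow> (AE f in PiM I' (\<lambda>_. gaussian_vec S). AE y in gaussian_vec S. det (?M J (f(\<iota> j := y))) \<noteq> 0)"
      proof (rule AE_cong)
        fix f assume f: "f \<in> space (PiM I' (\<lambda>_. gaussian_vec S))"
        show "(\<integral>\<^sup>+y. ?bad J (f(\<iota> j := y)) \<partial>gaussian_vec S) = 0 \<longleftrightarrow>
            (AE y in gaussian_vec S. det (?M J (f(\<iota> j := y))) \<noteq> 0)"
          by (subst nn_integral_0_iff_AE[OF m1[OF f]]) (simp add: indicator_def)
      qed
      finally show ?thesis .
    qed
    from insert.IH have "AE f in PiM I' (\<lambda>_. gaussian_vec S). AE y in gaussian_vec S. det (?M J (f(\<iota> j := y))) \<noteq> 0"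
      by (simp only: AE_iff)
    then have "AE f in PiM I' (\<lambda>_. gaussian_vec S). AE y in gaussian_vec S. det (?M (insert j J) (f(\<iota> j := y))) \<noteq> 0"
    proof eventually_elim
      case (elim f)
      moreover have eqJ: "?M J (f(\<iota> j := y)) = ?M J f" for y
        using insert.hyps \<iota>(1) by (auto simp: vec_eq_iff inj_eq)
      ultimately have nz: "det (?M J f) \<noteq> 0" by simp
      obtain a where a: "\<And>y. det (\<chi> i. if i = j then y else ?M J f $ i) = a \<bullet> y"
        using det_row_linear[of j "\<lambda>i. ?M J f $ i"] by blast
      \<comment> \<open>As \<open>j\<close> is not in \<open>J\<close>, row \<open>j\<close> is
        still a unit vector; the determinant, nonzero by induction, is therefore
        \<open>a \<bullet> axis j 1\<close>, which shows \<open>a \<noteq> 0\<close>.\<close>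
      have "?M J f = (\<chi> i. if i = j then axis j 1 else ?M J f $ i)"
        using insert.hyps by (auto simp: vec_eq_iff)
      then have "det (?M J f) = a \<bullet> axis j 1" using a[of "axis j 1"] by simp
      with nz have "a \<noteq> 0" by auto
      moreover have "?M (insert j J) (f(\<iota> j := y)) = (\<chi> i. if i = j then y else ?M J f $ i)" for y
        using insert.hyps \<iota>(1) by (auto simp: vec_eq_iff inj_eq)
      ultimately show "AE y in gaussian_vec S. det (?M (insert j J) (f(\<iota> j := y))) \<noteq> 0"
        using AE_gaussian_vec_inner_nonzero[of a S] by (simp add: a)
    qed
    then show ?case by (simp only: AE_iff)
  qed
qed

text \<open>Any CARD('m) of the vectors, selected by \<open>\<iota>\<close>, are almost surely
  independent, and that already gives full column rank.\<close>

lemma AE_PiM_gaussian_vec_invertible: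
  fixes S :: "real^'m^'m"
  assumes S: "sym_pos_def_mat S" and I: "finite I" and card: "CARD('m) \<le> card I"
  shows "AE \<phi> in PiM I (\<lambda>_. gaussian_vec S). invertible (\<Sum>i\<in>I. outer (\<phi> i))"
proof -
  obtain \<iota> :: "'m \<Rightarrow> 'a" where \<iota>: "inj \<iota>" "range \<iota> \<subseteq> I"
    using card_le_inj[of "UNIV :: 'm set" I] I card by auto
  have "AE \<phi> in PiM I (\<lambda>_. gaussian_vec S). det (\<chi> j. if j \<in> UNIV then \<phi> (\<iota> j) else axis j 1 :: real^'m^'m) \<noteq> 0"
    by (rule AE_PiM_gaussian_vec_det_nonzero[OF S I \<iota>])
  then show ?thesis
  proof (rule AE_mp, intro AE_I2 impI)
    fix \<phi> :: "'a \<Rightarrow> real^'m"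
    assume "det (\<chi> j. if j \<in> UNIV then \<phi> (\<iota> j) else axis j 1 :: real^'m^'m) \<noteq> 0"
    then have inv: "invertible ((\<chi> j. \<phi> (\<iota> j)) :: real^'m^'m)" by (simp add: invertible_det_nz)
    have "w = 0" if "\<forall>i\<in>I. \<phi> i \<bullet> w = 0" for w
    proof -
      have "((\<chi> j. \<phi> (\<iota> j)) :: real^'m^'m) *v w = 0"
        using that \<iota>(2) by (auto simp: vec_eq_iff matrix_vector_mul_component)
      with inv show ?thesis by (simp add: invertible_iff_ker)
    qed
    then show "invertible (\<Sum>i\<in>I. outer (\<phi> i))" by (simp add: invertible_sum_outer_iff I)
  qed
qed

text \<open>Treats both inverse moments at once: the weight \<open>w\<close> is integrated against
  the Laplace transform of \<open>D\<close>. Taking \<open>w t = 1\<close> yields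
  \<open>H y = y\<close>, and \<open>w t = t\<close> yields \<open>H y = y\<^sup>2\<close>.\<close>

lemma nn_integral_inv_Gram:
  fixes S :: "real^'m^'m" and w H :: "real \<Rightarrow> real"
  assumes S: "sym_pos_def_mat S" and b: "b \<bullet> (matrix_inv S *v b) = 1"
    and I: "finite I" "CARD('m) \<le> card I"
    and [measurable]: "w \<in> borel_measurable borel" "H \<in> borel_measurable borel"
    and w: "\<And>t. 0 \<le> t \<Longrightarrow> 0 \<le> w t"
    and H: "\<And>x. 0 < x \<Longrightarrow> (\<integral>\<^sup>+t. ennreal (w t * exp (- t * x)) * indicator {0..} t \<partial>lborel) = ennreal (H (1 / x))"
    and C: "(\<integral>\<^sup>+t. ennreal (w t * (1 + 2 * t) powr (- (real (card I) - real CARD('m) + 1) / 2)) * indicator {0..} t \<partial>lborel) = C"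
  shows "(\<integral>\<^sup>+\<phi>. ennreal (H (b \<bullet> (matrix_inv (\<Sum>i\<in>I. outer (\<phi> i)) *v b))) \<partial>PiM I (\<lambda>_. gaussian_vec S)) = C"
proof -
  define c where "c = matrix_inv S *v b"
  have cb: "c \<bullet> b = 1" using b by (simp add: c_def inner_commute)
  let ?G = "PiM I (\<lambda>_. gaussian_vec S)" and ?N = "PiM I (\<lambda>_. std_normal)"
  let ?T = "\<lambda>(\<phi>, x). \<lambda>i\<in>I. \<phi> i + (x i - c \<bullet> \<phi> i) *\<^sub>R b"
  let ?W = "\<lambda>\<phi>. \<Sum>i\<in>I. outer (\<phi> i)"
  let ?F = "\<lambda>\<phi>. ennreal (H (b \<bullet> (matrix_inv (?W \<phi>) *v b)))"
  interpret G: prob_space "gaussian_vec S" by (rule prob_space_gaussian_vec[OF S])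
  interpret NI: prob_space ?N by (intro prob_space_PiM prob_space_std_normal)
  interpret GI: prob_space ?G by (intro prob_space_PiM prob_space_gaussian_vec S)
  interpret GN: pair_sigma_finite ?G ?N ..
  interpret LN: pair_sigma_finite lborel ?N ..
  have T [measurable]: "?T \<in> ?G \<Otimes>\<^sub>M ?N \<rightarrow>\<^sub>M ?G"
    unfolding split_beta' by (rule measurable_restrict) measurable
  have F: "?F \<in> borel_measurable ?G" by measurable
  have distr: "distr (?G \<Otimes>\<^sub>M ?N) ?G ?T = ?G"
    by (rule distr_PiM_gaussian_vec_resample[OF S b c_def I(1)])
  have WT: "?W (?T (\<phi>, x)) = (\<Sum>i\<in>I. outer (\<phi> i + (x i - c \<bullet> \<phi> i) *\<^sub>R b))" for \<phi> x
    by simp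
  \<comment> \<open>Invertibility is needed twice: for the original sample, to have \<open>K\<close>
    positive definite, and for the resampled one, to identify the quadratic form with
    \<open>1 / D x\<close>.\<close>
  have AE_inv: "AE \<phi> in ?G. invertible (?W \<phi>)"
    by (rule AE_PiM_gaussian_vec_invertible[OF S I])
  then have "AE \<phi> in distr (?G \<Otimes>\<^sub>M ?N) ?G ?T. invertible (?W \<phi>)"
    by (simp only: distr)
  then have "AE \<omega> in ?G \<Otimes>\<^sub>M ?N. invertible (?W (?T \<omega>))"
    by (rule AE_distrD[OF T])
  then have AE_inv2: "AE \<phi> in ?G. AE x in ?N. invertible (?W (?T (\<phi>, x)))"
    by (rule GN.AE_pair)
  \<comment> \<open>Conditionally on \<open>\<phi>\<close> the value is the same constant for almost
    every \<open>\<phi>\<close>, because the Laplace transform of \<open>D\<close> depends only on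
    the dimensions.\<close>
  have inner: "(\<integral>\<^sup>+x. ?F (?T (\<phi>, x)) \<partial>?N) = C"
    if inv: "invertible (?W \<phi>)" and AE: "AE x in ?N. invertible (?W (?T (\<phi>, x)))" for \<phi>
  proof -
    interpret residual_split I b c \<phi>
      using I(1) cb inv by unfold_locales
    have "(\<integral>\<^sup>+x. ?F (?T (\<phi>, x)) \<partial>?N) =
        (\<integral>\<^sup>+x. (\<integral>\<^sup>+t. ennreal (w t * exp (- t * D x)) * indicator {0..} t \<partial>lborel) \<partial>?N)"
    proof (rule nn_integral_cong_AE, rule AE_mp[OF AE], intro AE_I2 impI)
      fix x assume "invertible (?W (?T (\<phi>, x)))"
      from inner_inv_resampled[OF this[unfolded WT]]
      show "?F (?T (\<phi>, x)) = (\<integral>\<^sup>+t. ennreal (w t * exp (- t * D x)) * indicator {0..} t \<partial>lborel)"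
        unfolding WT by (simp only: H)
    qed
    also have "\<dots> = (\<integral>\<^sup>+t. (\<integral>\<^sup>+x. ennreal (w t * exp (- t * D x)) * indicator {0..} t \<partial>?N) \<partial>lborel)"
      by (rule LN.Fubini') measurable
    also have "\<dots> = (\<integral>\<^sup>+t. ennreal (w t * (1 + 2 * t) powr (- (real (card I) - real CARD('m) + 1) / 2)) * indicator {0..} t \<partial>lborel)"
    proof (rule nn_integral_cong)
      fix t :: real
      show "(\<integral>\<^sup>+x. ennreal (w t * exp (- t * D x)) * indicator {0..} t \<partial>?N) =
          ennreal (w t * (1 + 2 * t) powr (- (real (card I) - real CARD('m) + 1) / 2)) * indicator {0..} t"
      proof (cases "0 \<le> t")
        case True
        define d where "d = 1 + 2 * t"
        have d: "0 < d" using True by (simp add: d_def)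
        have pow: "sqrt d ^ k = d powr (real k / 2)" for k
          using d by (simp add: powr_half_sqrt[symmetric] powr_powr powr_realpow[symmetric] mult.commute)
        have "sqrt d ^ CARD('m) / sqrt d ^ Suc (card I) = d powr (real CARD('m) / 2 - real (Suc (card I)) / 2)"
          unfolding pow by (rule powr_diff[symmetric])
        also have "real CARD('m) / 2 - real (Suc (card I)) / 2 = - (real (card I) - real CARD('m) + 1) / 2"
          by (simp add: field_simps)
        finally have e: "sqrt d ^ CARD('m) / sqrt d ^ Suc (card I) = d powr (- (real (card I) - real CARD('m) + 1) / 2)" .
        have "(\<integral>\<^sup>+x. ennreal (w t * exp (- t * D x)) * indicator {0..} t \<partial>?N) =
            (\<integral>\<^sup>+x. ennreal (w t) * ennreal (exp (- t * D x)) \<partial>?N)"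
          using True w by (intro nn_integral_cong) (simp add: ennreal_mult)
        also have "\<dots> = ennreal (w t) * ennreal (d powr (- (real (card I) - real CARD('m) + 1) / 2))"
          by (subst nn_integral_cmult) (simp_all only: nn_integral_exp_D[OF True] d_def[symmetric] e, measurable)
        finally show ?thesis using True w by (simp add: ennreal_mult d_def)
      qed simp
    qed
    also have "\<dots> = C" by (rule C)
    finally show ?thesis .
  qed
  have "(\<integral>\<^sup>+\<phi>. ?F \<phi> \<partial>?G) = (\<integral>\<^sup>+\<phi>. ?F \<phi> \<partial>distr (?G \<Otimes>\<^sub>M ?N) ?G ?T)" by (simp only: distr)
  also have "\<dots> = (\<integral>\<^sup>+\<omega>. ?F (?T \<omega>) \<partial>(?G \<Otimes>\<^sub>M ?N))"
    by (rule nn_integral_distr) measurable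
  also have "\<dots> = (\<integral>\<^sup>+\<phi>. (\<integral>\<^sup>+x. ?F (?T (\<phi>, x)) \<partial>?N) \<partial>?G)"
    by (rule NI.nn_integral_fst[symmetric]) (rule measurable_compose[OF T F])
  also have "\<dots> = (\<integral>\<^sup>+\<phi>. C \<partial>?G)"
  proof (rule nn_integral_cong_AE)
    show "AE \<phi> in ?G. (\<integral>\<^sup>+x. ?F (?T (\<phi>, x)) \<partial>?N) = C"
      using AE_inv AE_inv2
    proof eventually_elim
      case (elim \<phi>)
      then show ?case by (rule inner)
    qed
  qed
  also have "\<dots> = C" by (simp add: GI.emeasure_space_1)
  finally show ?thesis .
qed

text \<open>Homogeneity: for nonzero \<open>v\<close>, dividing by \<open>sqrt Q\<close> gives the
  normalised direction \<open>b\<close>, and the quadratic form scales by \<open>Q\<close>. The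
  degrees of freedom \<open>n - m + 1\<close> turn \<open>k - 2\<close> and \<open>k - 4\<close>
  into the stated denominators.\<close>

lemma nn_integral_inv_Gram_quadratic:
  fixes S :: "real^'m^'m" and I :: "'i set" and v :: "real^'m"
  defines "m \<equiv> real CARD('m)" and "n \<equiv> real (card I)" and "Q \<equiv> v \<bullet> (matrix_inv S *v v)"
  assumes S: "sym_pos_def_mat S" and I: "finite I" "CARD('m) + 3 < card I"
  shows "(\<integral>\<^sup>+\<phi>. ennreal (v \<bullet> (matrix_inv (\<Sum>i\<in>I. outer (\<phi> i)) *v v)) \<partial>PiM I (\<lambda>_. gaussian_vec S)) =
      ennreal (Q / (n - m - 1))"
    and "(\<integral>\<^sup>+\<phi>. ennreal ((v \<bullet> (matrix_inv (\<Sum>i\<in>I. outer (\<phi> i)) *v v))\<^sup>2) \<partial>PiM I (\<lambda>_. gaussian_vec S)) =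
      ennreal (Q\<^sup>2 / ((n - m - 1) * (n - m - 3)))"
proof -
  let ?G = "PiM I (\<lambda>_. gaussian_vec S)" and ?W = "\<lambda>\<phi>. \<Sum>i\<in>I. outer (\<phi> i)"
  have card: "CARD('m) \<le> card I" using I by simp
  have mn: "m + 3 < n" using I(2) unfolding m_def n_def by linarith
  have "(\<integral>\<^sup>+\<phi>. ennreal (v \<bullet> (matrix_inv (?W \<phi>) *v v)) \<partial>?G) = ennreal (Q / (n - m - 1)) \<and>
    (\<integral>\<^sup>+\<phi>. ennreal ((v \<bullet> (matrix_inv (?W \<phi>) *v v))\<^sup>2) \<partial>?G) = ennreal (Q\<^sup>2 / ((n - m - 1) * (n - m - 3)))"
  proof (cases "v = 0")
    case False
    then have Q: "0 < Q"
      using sym_pos_def_mat_matrix_inv[OF S] by (simp add: Q_def sym_pos_def_mat_def)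
    define b where "b = v /\<^sub>R sqrt Q"
    have v: "v = sqrt Q *\<^sub>R b" using Q by (simp add: b_def)
    have "Q = Q * (b \<bullet> (matrix_inv S *v b))"
      using Q unfolding Q_def by (subst (1 2) v) (simp add: matrix_vector_mult_scaleR Q_def)
    then have b: "b \<bullet> (matrix_inv S *v b) = 1" using Q by simp
    have scale: "v \<bullet> (A *v v) = Q * (b \<bullet> (A *v b))" for A
      using Q by (subst (1 2) v) (simp add: matrix_vector_mult_scaleR)
    have 1: "(\<integral>\<^sup>+\<phi>. ennreal (b \<bullet> (matrix_inv (?W \<phi>) *v b)) \<partial>?G) = ennreal (1 / (n - m - 1))"
    proof (rule nn_integral_inv_Gram[OF S b I(1) card, where w="\<lambda>_. 1" and H="\<lambda>y. y"])
      show "(\<integral>\<^sup>+t. ennreal (1 * exp (- t * x)) * indicator {0..} t \<partial>lborel) = ennreal (1 / x)" if "0 < x" for x :: real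
        using nn_integral_exp_Laplace(1)[OF that] by simp
      show "(\<integral>\<^sup>+t. ennreal (1 * (1 + 2 * t) powr (- (real (card I) - real CARD('m) + 1) / 2)) * indicator {0..} t \<partial>lborel) =
          ennreal (1 / (n - m - 1))"
        using nn_integral_powr_Laplace(1)[of "n - m + 1"] mn by (simp add: n_def m_def algebra_simps)
    qed auto
    have 2: "(\<integral>\<^sup>+\<phi>. ennreal ((b \<bullet> (matrix_inv (?W \<phi>) *v b))\<^sup>2) \<partial>?G) = ennreal (1 / ((n - m - 1) * (n - m - 3)))"
    proof (rule nn_integral_inv_Gram[OF S b I(1) card, where w="\<lambda>t. t" and H="\<lambda>y. y\<^sup>2"])
      show "(\<integral>\<^sup>+t. ennreal (t * exp (- t * x)) * indicator {0..} t \<partial>lborel) = ennreal ((1 / x)\<^sup>2)" if "0 < x" for x :: real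
        using nn_integral_exp_Laplace(2)[OF that] by (simp add: power_divide)
      show "(\<integral>\<^sup>+t. ennreal (t * (1 + 2 * t) powr (- (real (card I) - real CARD('m) + 1) / 2)) * indicator {0..} t \<partial>lborel) =
          ennreal (1 / ((n - m - 1) * (n - m - 3)))"
      proof -
        have "n - m + 1 - 2 = n - m - 1" "n - m + 1 - 4 = n - m - 3" by simp_all
        with nn_integral_powr_Laplace(2)[of "n - m + 1"] mn show ?thesis by (simp only: n_def m_def)
      qed
    qed auto
    show ?thesis
    proof
      have "(\<integral>\<^sup>+\<phi>. ennreal (v \<bullet> (matrix_inv (?W \<phi>) *v v)) \<partial>?G) =
          (\<integral>\<^sup>+\<phi>. ennreal Q * ennreal (b \<bullet> (matrix_inv (?W \<phi>) *v b)) \<partial>?G)"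
        using Q by (simp add: scale ennreal_mult')
      also have "\<dots> = ennreal Q * ennreal (1 / (n - m - 1))"
        by (subst nn_integral_cmult) (simp_all only: 1, measurable)
      also have "\<dots> = ennreal (Q / (n - m - 1))"
        using Q mn by (simp add: ennreal_mult[symmetric])
      finally show "(\<integral>\<^sup>+\<phi>. ennreal (v \<bullet> (matrix_inv (?W \<phi>) *v v)) \<partial>?G) = ennreal (Q / (n - m - 1))" .
      have "(\<integral>\<^sup>+\<phi>. ennreal ((v \<bullet> (matrix_inv (?W \<phi>) *v v))\<^sup>2) \<partial>?G) =
          (\<integral>\<^sup>+\<phi>. ennreal (Q\<^sup>2) * ennreal ((b \<bullet> (matrix_inv (?W \<phi>) *v b))\<^sup>2) \<partial>?G)"
        by (simp add: scale ennreal_mult power_mult_distrib)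
      also have "\<dots> = ennreal (Q\<^sup>2) * ennreal (1 / ((n - m - 1) * (n - m - 3)))"
        by (subst nn_integral_cmult) (simp_all only: 2, measurable)
      also have "\<dots> = ennreal (Q\<^sup>2 / ((n - m - 1) * (n - m - 3)))"
        using mn by (simp add: ennreal_mult[symmetric])
      finally show "(\<integral>\<^sup>+\<phi>. ennreal ((v \<bullet> (matrix_inv (?W \<phi>) *v v))\<^sup>2) \<partial>?G) =
          ennreal (Q\<^sup>2 / ((n - m - 1) * (n - m - 3)))" .
    qed
  qed (simp add: Q_def)
  then show "(\<integral>\<^sup>+\<phi>. ennreal (v \<bullet> (matrix_inv (?W \<phi>) *v v)) \<partial>?G) = ennreal (Q / (n - m - 1))"
    and "(\<integral>\<^sup>+\<phi>. ennreal ((v \<bullet> (matrix_inv (?W \<phi>) *v v))\<^sup>2) \<partial>?G) = ennreal (Q\<^sup>2 / ((n - m - 1) * (n - m - 3)))"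
    by blast+
qed

section \<open>Second and fourth moments of linear forms in the noise\<close>

lemma nn_integral_std_normal_affine:
  "(\<integral>\<^sup>+y. ennreal ((l + a * y)\<^sup>2) \<partial>std_normal) = ennreal (l\<^sup>2 + a\<^sup>2)"
  "(\<integral>\<^sup>+y. ennreal ((l + a * y) ^ 4) \<partial>std_normal) = ennreal (l ^ 4 + 6 * a\<^sup>2 * l\<^sup>2 + 3 * a ^ 4)"
proof -
  let ?\<eta> = std_normal_density
  have m: "has_bochner_integral lborel (\<lambda>x. ?\<eta> x * x ^ 0) 1" "has_bochner_integral lborel (\<lambda>x. ?\<eta> x * x ^ 1) 0"
    "has_bochner_integral lborel (\<lambda>x. ?\<eta> x * x ^ 2) 1" "has_bochner_integral lborel (\<lambda>x. ?\<eta> x * x ^ 3) 0"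
    "has_bochner_integral lborel (\<lambda>x. ?\<eta> x * x ^ 4) 3"
    using std_normal_moment_even[of 0] std_normal_moment_even[of 1] std_normal_moment_even[of 2]
      std_normal_moment_odd[of 0] std_normal_moment_odd[of 1]
    by (simp_all add: fact_numeral)
  note h = has_bochner_integral_mult_right
  have "has_bochner_integral lborel (\<lambda>x. l\<^sup>2 * (?\<eta> x * x ^ 0) + 2 * l * a * (?\<eta> x * x ^ 1) + a\<^sup>2 * (?\<eta> x * x ^ 2))
      (l\<^sup>2 * 1 + 2 * l * a * 0 + a\<^sup>2 * 1)"
    by (intro has_bochner_integral_add h m)
  then have 2: "has_bochner_integral lborel (\<lambda>x. ?\<eta> x * (l + a * x)\<^sup>2) (l\<^sup>2 + a\<^sup>2)"
    by (rule has_bochner_integral_cong[THEN iffD1, rotated -1]) (auto simp: power2_eq_square algebra_simps)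
  have "has_bochner_integral lborel (\<lambda>x. l ^ 4 * (?\<eta> x * x ^ 0) + 4 * l ^ 3 * a * (?\<eta> x * x ^ 1) +
      6 * a\<^sup>2 * l\<^sup>2 * (?\<eta> x * x ^ 2) + 4 * l * a ^ 3 * (?\<eta> x * x ^ 3) + a ^ 4 * (?\<eta> x * x ^ 4))
      (l ^ 4 * 1 + 4 * l ^ 3 * a * 0 + 6 * a\<^sup>2 * l\<^sup>2 * 1 + 4 * l * a ^ 3 * 0 + a ^ 4 * 3)"
    by (intro has_bochner_integral_add h m)
  then have 4: "has_bochner_integral lborel (\<lambda>x. ?\<eta> x * (l + a * x) ^ 4) (l ^ 4 + 6 * a\<^sup>2 * l\<^sup>2 + 3 * a ^ 4)"
    by (rule has_bochner_integral_cong[THEN iffD1, rotated -1])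
       (auto simp: power2_eq_square power3_eq_cube power4_eq_xxxx algebra_simps)
  have "(\<integral>\<^sup>+y. ennreal ((l + a * y)\<^sup>2) \<partial>std_normal) = (\<integral>\<^sup>+y. ennreal (?\<eta> y * (l + a * y)\<^sup>2) \<partial>lborel)"
    by (subst nn_integral_std_normal) (auto simp: ennreal_mult)
  also have "\<dots> = ennreal (l\<^sup>2 + a\<^sup>2)"
    using 2 by (subst nn_integral_eq_integral) (auto simp: has_bochner_integral_iff)
  finally show "(\<integral>\<^sup>+y. ennreal ((l + a * y)\<^sup>2) \<partial>std_normal) = ennreal (l\<^sup>2 + a\<^sup>2)" .
  have "(\<integral>\<^sup>+y. ennreal ((l + a * y) ^ 4) \<partial>std_normal) = (\<integral>\<^sup>+y. ennreal (?\<eta> y * (l + a * y) ^ 4) \<partial>lborel)"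
    by (subst nn_integral_std_normal) (auto simp: ennreal_mult)
  also have "\<dots> = ennreal (l ^ 4 + 6 * a\<^sup>2 * l\<^sup>2 + 3 * a ^ 4)"
    using 4 by (subst nn_integral_eq_integral) (auto simp: has_bochner_integral_iff)
  finally show "(\<integral>\<^sup>+y. ennreal ((l + a * y) ^ 4) \<partial>std_normal) = ennreal (l ^ 4 + 6 * a\<^sup>2 * l\<^sup>2 + 3 * a ^ 4)" .
qed

text \<open>Integrating out one coordinate at a time, with the remaining sum as the offset
  \<open>l\<close>. The fourth moment closes up because 3 A^2 + 6 a^2 A + 3 a^4 = 3 (A +
  a^2)^2.\<close>

lemma nn_integral_PiM_std_normal_linear:
  assumes "finite I"
  shows "(\<integral>\<^sup>+z. ennreal ((\<Sum>i\<in>I. a i * z i)\<^sup>2) \<partial>PiM I (\<lambda>_. std_normal)) = ennreal (\<Sum>i\<in>I. (a i)\<^sup>2)"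
    and "(\<integral>\<^sup>+z. ennreal ((\<Sum>i\<in>I. a i * z i) ^ 4) \<partial>PiM I (\<lambda>_. std_normal)) = ennreal (3 * (\<Sum>i\<in>I. (a i)\<^sup>2)\<^sup>2)"
  unfolding atomize_conj using assms
proof (induction I)
  case empty
  show ?case by simp
next
  case (insert j I)
  let ?N = "PiM I (\<lambda>_. std_normal)" and ?L = "\<lambda>z. \<Sum>i\<in>I. a i * z i" and ?A = "\<Sum>i\<in>I. (a i)\<^sup>2"
  interpret NI: prob_space ?N by (intro prob_space_PiM prob_space_std_normal)
  have IH: "(\<integral>\<^sup>+z. ennreal ((?L z)\<^sup>2) \<partial>?N) = ennreal ?A" "(\<integral>\<^sup>+z. ennreal ((?L z) ^ 4) \<partial>?N) = ennreal (3 * ?A\<^sup>2)"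
    using insert.IH by auto
  have L: "(\<Sum>i\<in>insert j I. a i * (z(j := y)) i) = ?L z + a j * y" for z y
  proof -
    have "(\<Sum>i\<in>I. a i * (z(j := y)) i) = ?L z" using insert.hyps by (intro sum.cong) auto
    then show ?thesis using insert.hyps by simp
  qed
  have A0: "0 \<le> ?A" by (simp add: sum_nonneg)
  have split: "(\<integral>\<^sup>+z. ennreal ((\<Sum>i\<in>insert j I. a i * z i) ^ p) \<partial>PiM (insert j I) (\<lambda>_. std_normal)) =
      (\<integral>\<^sup>+z. (\<integral>\<^sup>+y. ennreal ((?L z + a j * y) ^ p) \<partial>std_normal) \<partial>?N)" for p
    by (subst std_normals.product_nn_integral_insert) (use insert.hyps in \<open>simp_all only: L\<close>, measurable)
  have "(\<integral>\<^sup>+z. (\<integral>\<^sup>+y. ennreal ((?L z + a j * y)\<^sup>2) \<partial>std_normal) \<partial>?N) = ennreal ?A + ennreal ((a j)\<^sup>2)"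
    unfolding nn_integral_std_normal_affine
    by (simp add: nn_integral_add IH NI.emeasure_space_1)
  moreover have "(\<integral>\<^sup>+z. (\<integral>\<^sup>+y. ennreal ((?L z + a j * y) ^ 4) \<partial>std_normal) \<partial>?N) =
      ennreal (3 * ?A\<^sup>2) + ennreal (6 * (a j)\<^sup>2) * ennreal ?A + ennreal (3 * (a j) ^ 4)"
    unfolding nn_integral_std_normal_affine
    by (simp add: nn_integral_add nn_integral_cmult ennreal_mult IH NI.emeasure_space_1)
  moreover have "ennreal ?A + ennreal ((a j)\<^sup>2) = ennreal (\<Sum>i\<in>insert j I. (a i)\<^sup>2)"
    using A0 insert.hyps by (simp add: add.commute)
  moreover have "ennreal (3 * ?A\<^sup>2) + ennreal (6 * (a j)\<^sup>2) * ennreal ?A + ennreal (3 * (a j) ^ 4) =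
      ennreal (3 * (\<Sum>i\<in>insert j I. (a i)\<^sup>2)\<^sup>2)"
  proof -
    have "ennreal (3 * ?A\<^sup>2) + ennreal (6 * (a j)\<^sup>2) * ennreal ?A + ennreal (3 * (a j) ^ 4) =
        ennreal (3 * ?A\<^sup>2 + 6 * (a j)\<^sup>2 * ?A + 3 * (a j) ^ 4)"
      using A0 by (simp add: ennreal_mult)
    also have "3 * ?A\<^sup>2 + 6 * (a j)\<^sup>2 * ?A + 3 * (a j) ^ 4 = 3 * ((a j)\<^sup>2 + ?A)\<^sup>2"
      by (simp add: power2_sum algebra_simps flip: power_mult)
    finally show ?thesis using insert.hyps by simp
  qed
  ultimately show ?case unfolding split by (simp only: simp_thms)
qed

section \<open>Moments of the prediction loss\<close>

lemma AE_PiM_atMost_gaussian_vec_invertible: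
  fixes S :: "real^'m^'m"
  assumes S: "sym_pos_def_mat S" and n: "CARD('m) \<le> n"
  shows "AE \<phi> in PiM {..n} (\<lambda>_. gaussian_vec S). invertible (\<Sum>i<n. outer (\<phi> i))"
proof -
  interpret G: prob_space "gaussian_vec S" by (rule prob_space_gaussian_vec[OF S])
  interpret GP: product_prob_space "\<lambda>_::nat. gaussian_vec S" "{..n}" ..
  let ?r = "\<lambda>\<phi>. restrict \<phi> {..<n}"
  have "AE \<phi> in PiM {..<n} (\<lambda>_. gaussian_vec S). invertible (\<Sum>i<n. outer (\<phi> i))"
    by (rule AE_PiM_gaussian_vec_invertible[OF S]) (use n in auto)
  moreover have "distr (PiM {..n} (\<lambda>_. gaussian_vec S)) (PiM {..<n} (\<lambda>_. gaussian_vec S)) ?r =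
      PiM {..<n} (\<lambda>_. gaussian_vec S)"
    by (rule GP.distr_PiM_restrict_finite) auto
  ultimately have "AE \<phi> in distr (PiM {..n} (\<lambda>_. gaussian_vec S)) (PiM {..<n} (\<lambda>_. gaussian_vec S)) ?r.
      invertible (\<Sum>i<n. outer (\<phi> i))"
    by (simp only:)
  from AE_distrD[OF _ this] show ?thesis
    by (simp add: measurable_restrict_subset)
qed

text \<open>The new vector \<open>v\<close> is split off and held fixed while the training sample is
  integrated, giving multiples of \<open>Q v\<close> and its square; the chi-squared moments of
  \<open>Q v\<close> then finish the average.\<close>

lemma nn_integral_leverage:
  fixes S :: "real^'m^'m" and n :: nat
  defines "m \<equiv> real CARD('m)" and "N \<equiv> real n"
  defines "q \<equiv> (\<lambda>\<phi> :: nat \<Rightarrow> real^'m. \<phi> n \<bullet> (matrix_inv (\<Sum>i<n. outer (\<phi> i)) *v \<phi> n))"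
  assumes S: "sym_pos_def_mat S" and n: "CARD('m) + 3 < n"
  shows "(\<integral>\<^sup>+\<phi>. ennreal (1 + q \<phi>) \<partial>PiM {..n} (\<lambda>_. gaussian_vec S)) = ennreal (1 + m / (N - m - 1))"
    and "(\<integral>\<^sup>+\<phi>. ennreal ((1 + q \<phi>)\<^sup>2) \<partial>PiM {..n} (\<lambda>_. gaussian_vec S)) =
      ennreal (1 + 2 * (m / (N - m - 1)) + m * (m + 2) / ((N - m - 1) * (N - m - 3)))"
proof -
  interpret G: prob_space "gaussian_vec S" by (rule prob_space_gaussian_vec[OF S])
  interpret GP: product_prob_space "\<lambda>_::nat. gaussian_vec S" UNIV ..
  let ?G = "PiM {..<n} (\<lambda>_. gaussian_vec S)"
  interpret GI: prob_space ?G by (intro prob_space_PiM prob_space_gaussian_vec S)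
  define a where "a = N - m - 1"
  define b where "b = N - m - 3"
  define p where "p v \<phi> = v \<bullet> (matrix_inv (\<Sum>i<n. outer (\<phi> i)) *v v)" for v :: "real^'m" and \<phi> :: "nat \<Rightarrow> real^'m"
  define Q where "Q v = v \<bullet> (matrix_inv S *v v)" for v
  have pos: "0 < a" "0 < b" "0 \<le> m" using n unfolding a_def b_def m_def N_def by auto
  have Q0: "0 \<le> Q v" for v
    using sym_pos_def_mat_matrix_inv[OF S] unfolding Q_def sym_pos_def_mat_def
    by (cases "v = 0") (auto intro: less_imp_le)
  have [measurable]: "Q \<in> borel_measurable borel" unfolding Q_def[abs_def] by measurable
  have [measurable]: "p v \<in> borel_measurable ?G" for v
    unfolding p_def[abs_def] by measurable
  have [measurable]: "q \<in> borel_measurable (PiM (insert n {..<n}) (\<lambda>_. gaussian_vec S))"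
    unfolding q_def by measurable
  have qp: "q (\<phi>(n := v)) = p v \<phi>" for \<phi> v
  proof -
    have "(\<Sum>i<n. outer ((\<phi>(n := v)) i)) = (\<Sum>i<n. outer (\<phi> i))" by (intro sum.cong) auto
    then show ?thesis by (simp add: q_def p_def)
  qed
  have ins: "{..n} = insert n {..<n}" by auto
  have p1: "(\<integral>\<^sup>+\<phi>. ennreal (p v \<phi>) \<partial>?G) = ennreal (Q v / a)"
    and p2: "(\<integral>\<^sup>+\<phi>. ennreal ((p v \<phi>)\<^sup>2) \<partial>?G) = ennreal ((Q v)\<^sup>2 / (a * b))" for v
    using nn_integral_inv_Gram_quadratic[OF S, of "{..<n}" v] n
    by (simp_all add: p_def Q_def a_def b_def m_def N_def)
  \<comment> \<open>\<open>ennreal\<close> truncates negative numbers to 0, so expanding sums inside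
    it needs nonnegativity, available where the Gram matrix is invertible.\<close>
  have AE_p: "AE \<phi> in ?G. 0 \<le> p v \<phi>" for v
  proof -
    have "AE \<phi> in ?G. invertible (\<Sum>i<n. outer (\<phi> i))"
      by (rule AE_PiM_gaussian_vec_invertible[OF S]) (use n in auto)
    then show ?thesis
    proof eventually_elim
      case (elim \<phi>)
      have "sym_pos_def_mat (matrix_inv (\<Sum>i<n. outer (\<phi> i)))"
        by (rule sym_pos_def_mat_matrix_inv[OF sym_pos_def_mat_sum_outer[OF _ elim]]) simp
      then show ?case unfolding p_def sym_pos_def_mat_def
        by (cases "v = 0") (auto intro: less_imp_le)
    qed
  qed
  have "(\<integral>\<^sup>+\<phi>. ennreal (1 + q \<phi>) \<partial>PiM {..n} (\<lambda>_. gaussian_vec S)) =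
      (\<integral>\<^sup>+v. (\<integral>\<^sup>+\<phi>. ennreal (1 + p v \<phi>) \<partial>?G) \<partial>gaussian_vec S)"
    unfolding ins by (subst GP.product_nn_integral_insert_rev) (simp_all add: qp)
  also have "\<dots> = (\<integral>\<^sup>+v. 1 + ennreal (1 / a) * ennreal (Q v) \<partial>gaussian_vec S)"
  proof (rule nn_integral_cong)
    fix v
    have "(\<integral>\<^sup>+\<phi>. ennreal (1 + p v \<phi>) \<partial>?G) = (\<integral>\<^sup>+\<phi>. 1 + ennreal (p v \<phi>) \<partial>?G)"
      using AE_p[of v] by (intro nn_integral_cong_AE) (auto elim!: eventually_mono)
    also have "\<dots> = 1 + ennreal (Q v / a)"
      by (simp add: nn_integral_add p1 GI.emeasure_space_1)
    finally show "(\<integral>\<^sup>+\<phi>. ennreal (1 + p v \<phi>) \<partial>?G) = 1 + ennreal (1 / a) * ennreal (Q v)"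
      using pos Q0 by (simp add: ennreal_mult[symmetric])
  qed
  also have "\<dots> = 1 + ennreal (1 / a) * ennreal m"
    using G.emeasure_space_1 nn_integral_gaussian_vec_quadratic(1)[OF S]
    by (simp add: nn_integral_add nn_integral_cmult Q_def m_def)
  also have "\<dots> = ennreal (1 + m / a)"
    using pos by (simp add: ennreal_mult[symmetric])
  finally show "(\<integral>\<^sup>+\<phi>. ennreal (1 + q \<phi>) \<partial>PiM {..n} (\<lambda>_. gaussian_vec S)) = ennreal (1 + m / (N - m - 1))"
    by (simp add: a_def)
  have "(\<integral>\<^sup>+\<phi>. ennreal ((1 + q \<phi>)\<^sup>2) \<partial>PiM {..n} (\<lambda>_. gaussian_vec S)) =
      (\<integral>\<^sup>+v. (\<integral>\<^sup>+\<phi>. ennreal ((1 + p v \<phi>)\<^sup>2) \<partial>?G) \<partial>gaussian_vec S)"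
    unfolding ins by (subst GP.product_nn_integral_insert_rev) (simp_all add: qp)
  also have "\<dots> = (\<integral>\<^sup>+v. 1 + ennreal (2 / a) * ennreal (Q v) + ennreal (1 / (a * b)) * ennreal ((Q v)\<^sup>2) \<partial>gaussian_vec S)"
  proof (rule nn_integral_cong)
    fix v
    have "(\<integral>\<^sup>+\<phi>. ennreal ((1 + p v \<phi>)\<^sup>2) \<partial>?G) = (\<integral>\<^sup>+\<phi>. 1 + 2 * ennreal (p v \<phi>) + ennreal ((p v \<phi>)\<^sup>2) \<partial>?G)"
    proof (rule nn_integral_cong_AE, use AE_p[of v] in eventually_elim)
      case (elim \<phi>)
      have "(1 + p v \<phi>)\<^sup>2 = 1 + 2 * p v \<phi> + (p v \<phi>)\<^sup>2" by (simp add: power2_sum)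
      then show ?case using elim by (simp add: ennreal_mult)
    qed
    also have "\<dots> = 1 + 2 * ennreal (Q v / a) + ennreal ((Q v)\<^sup>2 / (a * b))"
      by (simp add: nn_integral_add nn_integral_cmult p1 p2 GI.emeasure_space_1)
    also have "2 * ennreal (Q v / a) = ennreal (2 / a) * ennreal (Q v)"
    proof -
      have "2 * ennreal (Q v / a) = ennreal 2 * ennreal (Q v / a)" by simp
      also have "\<dots> = ennreal (2 * (Q v / a))"
        using pos Q0[of v] by (intro ennreal_mult[symmetric]) auto
      also have "2 * (Q v / a) = 2 / a * Q v" by simp
      also have "ennreal (2 / a * Q v) = ennreal (2 / a) * ennreal (Q v)"
        using pos Q0[of v] by (intro ennreal_mult) auto
      finally show ?thesis .
    qed
    finally show "(\<integral>\<^sup>+\<phi>. ennreal ((1 + p v \<phi>)\<^sup>2) \<partial>?G) =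
        1 + ennreal (2 / a) * ennreal (Q v) + ennreal (1 / (a * b)) * ennreal ((Q v)\<^sup>2)"
      using pos by (simp add: ennreal_mult[symmetric])
  qed
  also have "\<dots> = 1 + ennreal (2 / a) * ennreal m + ennreal (1 / (a * b)) * ennreal (m * (m + 2))"
    using G.emeasure_space_1 nn_integral_gaussian_vec_quadratic[OF S]
    by (simp add: nn_integral_add nn_integral_cmult Q_def m_def)
  also have "\<dots> = ennreal (1 + 2 * (m / a) + m * (m + 2) / (a * b))"
    using pos by (simp add: ennreal_mult[symmetric])
  finally show "(\<integral>\<^sup>+\<phi>. ennreal ((1 + q \<phi>)\<^sup>2) \<partial>PiM {..n} (\<lambda>_. gaussian_vec S)) =
      ennreal (1 + 2 * (m / (N - m - 1)) + m * (m + 2) / ((N - m - 1) * (N - m - 3)))"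
    by (simp add: a_def b_def)
qed

text \<open>The signal cancels since \<open>matrix_inv W *v (W *v \<theta>) = \<theta>\<close>,
  leaving a linear form in the noise. With \<open>u = matrix_inv W *v \<phi> n\<close>, the squared
  coefficients of the training noises sum to \<open>u \<bullet> (W *v u)\<close>, which collapses to
  the leverage; the new noise contributes the 1.\<close>

lemma prediction_error_eq:
  fixes n :: nat and \<phi> :: "nat \<Rightarrow> real^'m" and z :: "nat \<Rightarrow> real" and \<theta> :: "real^'m" and \<sigma> :: real
  defines "W \<equiv> \<Sum>i<n. outer (\<phi> i)"
  defines "\<alpha> \<equiv> (\<lambda>i. if i = n then 1 else - (\<phi> n \<bullet> (matrix_inv W *v \<phi> i)))"
  defines "y \<equiv> (\<lambda>i. \<phi> i \<bullet> \<theta> + \<sigma> * z i)"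
  assumes inv: "invertible W"
  shows "y n - \<phi> n \<bullet> theta_LS n \<phi> y = \<sigma> * (\<Sum>i\<le>n. \<alpha> i * z i)"
    and "(\<Sum>i\<le>n. (\<alpha> i)\<^sup>2) = 1 + \<phi> n \<bullet> (matrix_inv W *v \<phi> n)"
proof -
  have spd: "sym_pos_def_mat W"
    using inv unfolding W_def by (intro sym_pos_def_mat_sum_outer) auto
  have sym: "transpose (matrix_inv W) = matrix_inv W"
    using sym_pos_def_mat_matrix_inv[OF spd] by (simp add: sym_pos_def_mat_def)
  have ins: "{..n} = insert n {..<n}" by auto
  have lin: "matrix_inv W *v (\<Sum>i<n. f i) = (\<Sum>i<n. matrix_inv W *v f i)" for f
    by (rule linear_sum) simp
  have "(\<Sum>i<n. y i *\<^sub>R \<phi> i) = W *v \<theta> + \<sigma> *\<^sub>R (\<Sum>i<n. z i *\<^sub>R \<phi> i)"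
    by (simp add: y_def W_def sum_outer_mult_vec scaleR_add_left sum.distrib scaleR_sum_right)
  then have "theta_LS n \<phi> y = \<theta> + \<sigma> *\<^sub>R (\<Sum>i<n. z i *\<^sub>R (matrix_inv W *v \<phi> i))"
    unfolding theta_LS_def W_def[symmetric]
    by (simp add: matrix_vector_right_distrib matrix_inv_mult_vec inv matrix_vector_mult_scaleR lin)
  then have "y n - \<phi> n \<bullet> theta_LS n \<phi> y = \<sigma> * (z n - (\<Sum>i<n. z i * (\<phi> n \<bullet> (matrix_inv W *v \<phi> i))))"
    by (simp add: y_def inner_add_right inner_sum_right right_diff_distrib)
  also have "z n - (\<Sum>i<n. z i * (\<phi> n \<bullet> (matrix_inv W *v \<phi> i))) = (\<Sum>i\<le>n. \<alpha> i * z i)"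
    unfolding ins by (simp add: \<alpha>_def sum_negf[symmetric] mult.commute)
  finally show "y n - \<phi> n \<bullet> theta_LS n \<phi> y = \<sigma> * (\<Sum>i\<le>n. \<alpha> i * z i)" .
  define u where "u = matrix_inv W *v \<phi> n"
  have "(\<Sum>i<n. (\<phi> n \<bullet> (matrix_inv W *v \<phi> i))\<^sup>2) = (\<Sum>i<n. (\<phi> i \<bullet> u) * (\<phi> i \<bullet> u))"
  proof (rule sum.cong[OF refl])
    fix i
    have "\<phi> n \<bullet> (matrix_inv W *v \<phi> i) = \<phi> i \<bullet> u"
      unfolding u_def inner_matrix_symm[OF sym, of "\<phi> n" "\<phi> i"] by (rule inner_commute)
    then show "(\<phi> n \<bullet> (matrix_inv W *v \<phi> i))\<^sup>2 = (\<phi> i \<bullet> u) * (\<phi> i \<bullet> u)"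
      by (simp only: power2_eq_square)
  qed
  also have "\<dots> = u \<bullet> (W *v u)" by (simp only: W_def inner_sum_outer_mult_vec)
  also have "W *v u = \<phi> n" unfolding u_def by (rule matrix_inv_mult_vec(2)[OF inv])
  also have "u \<bullet> \<phi> n = \<phi> n \<bullet> u" by (rule inner_commute)
  finally show "(\<Sum>i\<le>n. (\<alpha> i)\<^sup>2) = 1 + \<phi> n \<bullet> (matrix_inv W *v \<phi> n)"
    unfolding ins by (simp add: \<alpha>_def u_def)
qed

text \<open>As \<open>c \<le> \<mu>\<close>, the second moment about \<open>c\<close> is at most \<open>s - c\<^sup>2\<close>, which would be the variance if \<open>c\<close>
  were the mean.\<close>
lemma (in prob_space) prob_le_second_moment_about:
  fixes X :: "'a \<Rightarrow> real"
  assumes [measurable]: "X \<in> borel_measurable M" and nonneg: "\<And>\<omega>. 0 \<le> X \<omega>"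
    and X1: "(\<integral>\<^sup>+\<omega>. ennreal (X \<omega>) \<partial>M) = ennreal \<mu>" and X2: "(\<integral>\<^sup>+\<omega>. ennreal ((X \<omega>)\<^sup>2) \<partial>M) = ennreal s"
    and c: "0 \<le> c" "c \<le> \<mu>" "c\<^sup>2 < s" and \<delta>: "0 < \<delta>"
  shows "1 - \<delta> \<le> prob {\<omega> \<in> space M. X \<omega> \<le> c + sqrt ((s - c\<^sup>2) / \<delta>)}"
proof -
  define \<epsilon> where "\<epsilon> = sqrt ((s - c\<^sup>2) / \<delta>)"
  have \<epsilon>: "0 < \<epsilon>" "\<epsilon>\<^sup>2 = (s - c\<^sup>2) / \<delta>" using c \<delta> by (simp_all add: \<epsilon>_def)
  have s0: "0 \<le> s" using c by (smt (verit) zero_le_power2)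
  have i1: "integrable M X" and e1: "expectation X = \<mu>"
    using X1 c nonneg by (auto intro!: integrableI_nn_integral_finite simp: integral_eq_nn_integral)
  have i2: "integrable M (\<lambda>\<omega>. (X \<omega>)\<^sup>2)" and e2: "expectation (\<lambda>\<omega>. (X \<omega>)\<^sup>2) = s"
    using X2 s0 by (auto intro!: integrableI_nn_integral_finite simp: integral_eq_nn_integral)
  have eq: "(\<lambda>\<omega>. (X \<omega> - c)\<^sup>2) = (\<lambda>\<omega>. (X \<omega>)\<^sup>2 - 2 * c * X \<omega> + c\<^sup>2)"
    by (simp add: power2_diff algebra_simps)
  have i: "integrable M (\<lambda>\<omega>. (X \<omega> - c)\<^sup>2)" unfolding eq using i1 i2 by simp
  have e: "expectation (\<lambda>\<omega>. (X \<omega> - c)\<^sup>2) = s - 2 * c * \<mu> + c\<^sup>2"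
    unfolding eq using i1 i2 by (simp add: e1 e2 prob_space)
  have "c * c \<le> c * \<mu>" using c by (intro mult_left_mono) auto
  then have e_le: "expectation (\<lambda>\<omega>. (X \<omega> - c)\<^sup>2) \<le> s - c\<^sup>2"
    unfolding e by (simp add: power2_eq_square)
  have "prob {\<omega> \<in> space M. \<not> X \<omega> \<le> c + \<epsilon>} \<le> prob {\<omega> \<in> space M. \<epsilon>\<^sup>2 \<le> (X \<omega> - c)\<^sup>2}"
    using \<epsilon>(1) by (intro finite_measure_mono) (auto intro!: power_mono)
  also have "\<dots> \<le> expectation (\<lambda>\<omega>. (X \<omega> - c)\<^sup>2) / \<epsilon>\<^sup>2"
    using \<epsilon>(1) by (intro integral_Markov_inequality_measure[OF i, where A="{}"]) auto
  also have "\<dots> \<le> (s - c\<^sup>2) / \<epsilon>\<^sup>2"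
    using e_le by (intro divide_right_mono) auto
  also have "\<dots> = \<delta>" using c \<delta> by (simp add: \<epsilon>(2))
  finally have "prob {\<omega> \<in> space M. \<not> X \<omega> \<le> c + \<epsilon>} \<le> \<delta>" .
  moreover have "prob {\<omega> \<in> space M. \<not> X \<omega> \<le> c + \<epsilon>} = 1 - prob {\<omega> \<in> space M. X \<omega> \<le> c + \<epsilon>}"
    by (rule prob_neg) measurable
  ultimately show ?thesis by (simp add: \<epsilon>_def)
qed

text \<open>Noise is integrated first, with the features fixed: the scaled error is then a linear
  form whose squared coefficients sum to one plus the leverage. The leverage moments complete the
  computation.\<close>

lemma nn_integral_prediction_loss:
  fixes S :: "real^'m^'m" and n :: nat and \<theta> :: "real^'m" and \<sigma> :: real
  defines "m \<equiv> real CARD('m)" and "N \<equiv> real n"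
  defines "e \<equiv> (\<lambda>\<omega>. let y = (\<lambda>i. fst \<omega> i \<bullet> \<theta> + \<sigma> * snd \<omega> i) in y n - fst \<omega> n \<bullet> theta_LS n (fst \<omega>) y)"
  assumes S: "sym_pos_def_mat S" and n: "CARD('m) + 3 < n" and \<sigma>: "0 < \<sigma>"
  shows "e \<in> borel_measurable (sample_space n S)"
    and "(\<integral>\<^sup>+\<omega>. ennreal ((e \<omega> / \<sigma>)\<^sup>2) \<partial>sample_space n S) = ennreal (1 + m / (N - m - 1))"
    and "(\<integral>\<^sup>+\<omega>. ennreal (((e \<omega> / \<sigma>)\<^sup>2)\<^sup>2) \<partial>sample_space n S) =
      ennreal (3 * (1 + 2 * (m / (N - m - 1)) + m * (m + 2) / ((N - m - 1) * (N - m - 3))))"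
proof -
  let ?G = "PiM {..n} (\<lambda>_. gaussian_vec S)" and ?N = "PiM {..n} (\<lambda>_. std_normal)"
  let ?q = "\<lambda>\<phi> :: nat \<Rightarrow> real^'m. \<phi> n \<bullet> (matrix_inv (\<Sum>i<n. outer (\<phi> i)) *v \<phi> n)"
  interpret NI: prob_space ?N by (intro prob_space_PiM prob_space_std_normal)
  have [measurable]: "(\<lambda>\<omega>. fst \<omega> i) \<in> borel_measurable (?G \<Otimes>\<^sub>M ?N)"
    "(\<lambda>\<omega>. snd \<omega> i) \<in> borel_measurable (?G \<Otimes>\<^sub>M ?N)" if "i \<le> n" for i
    using measurable_compose[OF measurable_fst measurable_component_singleton[of i "{..n}" "\<lambda>_. gaussian_vec S"]]
      measurable_compose[OF measurable_snd measurable_component_singleton[of i "{..n}" "\<lambda>_. std_normal"]] that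
    by (simp_all cong: measurable_cong_sets)
  have [measurable]: "(\<lambda>\<omega>. \<Sum>i<n. outer (fst \<omega> i)) \<in> borel_measurable (?G \<Otimes>\<^sub>M ?N)"
    by (intro borel_measurable_sum borel_measurable_outer) simp
  have [measurable]: "(\<lambda>\<omega>. \<Sum>i<n. (fst \<omega> i \<bullet> \<theta> + \<sigma> * snd \<omega> i) *\<^sub>R fst \<omega> i) \<in> borel_measurable (?G \<Otimes>\<^sub>M ?N)"
    by (intro borel_measurable_sum) simp
  have em [measurable]: "e \<in> borel_measurable (?G \<Otimes>\<^sub>M ?N)"
    unfolding e_def Let_def theta_LS_def by measurable
  then show "e \<in> borel_measurable (sample_space n S)"
    unfolding sample_space_def .
  have AE: "AE \<phi> in ?G. invertible (\<Sum>i<n. outer (\<phi> i))"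
    by (rule AE_PiM_atMost_gaussian_vec_invertible[OF S]) (use n in simp)
  have [measurable]: "?q \<in> borel_measurable ?G"
  proof -
    have [measurable]: "(\<lambda>\<phi>. \<Sum>i<n. outer (\<phi> i)) \<in> borel_measurable ?G"
      by (intro borel_measurable_sum borel_measurable_outer) simp
    show ?thesis by measurable
  qed
  have noise: "(\<integral>\<^sup>+z. ennreal ((e (\<phi>, z) / \<sigma>)\<^sup>2) \<partial>?N) = ennreal (1 + ?q \<phi>)"
    "(\<integral>\<^sup>+z. ennreal (((e (\<phi>, z) / \<sigma>)\<^sup>2)\<^sup>2) \<partial>?N) = ennreal (3 * (1 + ?q \<phi>)\<^sup>2)"
    if inv: "invertible (\<Sum>i<n. outer (\<phi> i))" for \<phi>
  proof -
    let ?\<alpha> = "\<lambda>i. if i = n then 1 else - (\<phi> n \<bullet> (matrix_inv (\<Sum>i<n. outer (\<phi> i)) *v \<phi> i))"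
    have "e (\<phi>, z) = \<sigma> * (\<Sum>i\<le>n. ?\<alpha> i * z i)" for z
      using prediction_error_eq(1)[OF inv, of \<theta> \<sigma> z] by (simp add: e_def Let_def)
    then have e: "e (\<phi>, z) / \<sigma> = (\<Sum>i\<le>n. ?\<alpha> i * z i)" for z
      using \<sigma> by simp
    show "(\<integral>\<^sup>+z. ennreal ((e (\<phi>, z) / \<sigma>)\<^sup>2) \<partial>?N) = ennreal (1 + ?q \<phi>)"
      unfolding e by (subst nn_integral_PiM_std_normal_linear(1)) (simp_all only: prediction_error_eq(2)[OF inv] finite_atMost)
    have "(\<integral>\<^sup>+z. ennreal ((e (\<phi>, z) / \<sigma>) ^ 4) \<partial>?N) = ennreal (3 * (1 + ?q \<phi>)\<^sup>2)"
      unfolding e by (subst nn_integral_PiM_std_normal_linear(2)) (simp_all only: prediction_error_eq(2)[OF inv] finite_atMost)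
    then show "(\<integral>\<^sup>+z. ennreal (((e (\<phi>, z) / \<sigma>)\<^sup>2)\<^sup>2) \<partial>?N) = ennreal (3 * (1 + ?q \<phi>)\<^sup>2)"
      by (simp flip: power_mult)
  qed
  have "(\<integral>\<^sup>+\<omega>. ennreal ((e \<omega> / \<sigma>)\<^sup>2) \<partial>sample_space n S) = (\<integral>\<^sup>+\<phi>. (\<integral>\<^sup>+z. ennreal ((e (\<phi>, z) / \<sigma>)\<^sup>2) \<partial>?N) \<partial>?G)"
    unfolding sample_space_def by (rule NI.nn_integral_fst[symmetric]) measurable
  also have "\<dots> = (\<integral>\<^sup>+\<phi>. ennreal (1 + ?q \<phi>) \<partial>?G)"
    using AE by (intro nn_integral_cong_AE) (auto elim!: eventually_mono simp only: noise)
  also have "\<dots> = ennreal (1 + m / (N - m - 1))"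
    unfolding m_def N_def by (rule nn_integral_leverage(1)[OF S n])
  finally show "(\<integral>\<^sup>+\<omega>. ennreal ((e \<omega> / \<sigma>)\<^sup>2) \<partial>sample_space n S) = ennreal (1 + m / (N - m - 1))" .
  have "(\<integral>\<^sup>+\<omega>. ennreal (((e \<omega> / \<sigma>)\<^sup>2)\<^sup>2) \<partial>sample_space n S) = (\<integral>\<^sup>+\<phi>. (\<integral>\<^sup>+z. ennreal (((e (\<phi>, z) / \<sigma>)\<^sup>2)\<^sup>2) \<partial>?N) \<partial>?G)"
    unfolding sample_space_def by (rule NI.nn_integral_fst[symmetric]) measurable
  also have "\<dots> = (\<integral>\<^sup>+\<phi>. ennreal 3 * ennreal ((1 + ?q \<phi>)\<^sup>2) \<partial>?G)"
  proof (rule nn_integral_cong_AE, use AE in eventually_elim)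
    case (elim \<phi>)
    show ?case unfolding noise(2)[OF elim] by (rule ennreal_mult) auto
  qed
  also have "\<dots> = ennreal 3 * (\<integral>\<^sup>+\<phi>. ennreal ((1 + ?q \<phi>)\<^sup>2) \<partial>?G)"
    by (rule nn_integral_cmult) measurable
  also have "\<dots> = ennreal 3 * ennreal (1 + 2 * (m / (N - m - 1)) + m * (m + 2) / ((N - m - 1) * (N - m - 3)))"
    unfolding m_def N_def nn_integral_leverage(2)[OF S n] ..
  also have "\<dots> = ennreal (3 * (1 + 2 * (m / (N - m - 1)) + m * (m + 2) / ((N - m - 1) * (N - m - 3))))"
    by (rule ennreal_mult'[symmetric]) simp
  finally show "(\<integral>\<^sup>+\<omega>. ennreal (((e \<omega> / \<sigma>)\<^sup>2)\<^sup>2) \<partial>sample_space n S) =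
      ennreal (3 * (1 + 2 * (m / (N - m - 1)) + m * (m + 2) / ((N - m - 1) * (N - m - 3))))" .
qed

lemma prob_space_sample_space:
  assumes "sym_pos_def_mat S"
  shows "prob_space (sample_space n S)"
  unfolding sample_space_def
  by (intro prob_space_pair prob_space_PiM prob_space_gaussian_vec prob_space_std_normal assms)

theorem theorem2:
  fixes n :: nat and sigma :: real and theta :: "real^'m" and S :: "real^'m^'m" and delta :: real
  assumes "n > CARD('m) + 3"
    and "sigma > 0"
    and "sym_pos_def_mat S"
    and "0 < delta" and "delta < 1"
  shows "measure (sample_space n S)
     {\<omega> \<in> space (sample_space n S).
        (let phi = fst \<omega>; z = snd \<omega>;
             y = (\<lambda>i. phi i \<bullet> theta + sigma * z i);
             thLS = theta_LS n phi y;
             loss = (y n - phi n \<bullet> thLS)\<^sup>2;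
             m = real CARD('m); N = real n
         in loss \<le> sigma\<^sup>2 / (N - m - 1) *
              (m + 1 / sqrt delta *
                 sqrt ((m ^ 3 - m\<^sup>2 * (N - 3) - 3 * m * (N - 3) * (N - 1) + 3 * (N - 3) * (N - 1)\<^sup>2)
                       / (N - m - 3))))}
     \<ge> 1 - delta"
proof -
  define m where "m = real CARD('m)"
  define N where "N = real n"
  define a where "a = N - m - 1"
  define b where "b = N - m - 3"
  define c where "c = m / a"
  define s where "s = 3 * (1 + 2 * (m / a) + m * (m + 2) / (a * b))"
  define e where "e \<omega> = (let y = (\<lambda>i. fst \<omega> i \<bullet> theta + sigma * snd \<omega> i) in y n - fst \<omega> n \<bullet> theta_LS n (fst \<omega>) y)"
    for \<omega> :: "(nat \<Rightarrow> real^'m) \<times> (nat \<Rightarrow> real)"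
  define X where "X \<omega> = (e \<omega> / sigma)\<^sup>2" for \<omega>
  define P where "P = m ^ 3 - m\<^sup>2 * (N - 3) - 3 * m * (N - 3) * (N - 1) + 3 * (N - 3) * (N - 1)\<^sup>2"
  have pos: "0 < a" "0 < b" "0 \<le> m" and ab: "b = a - 2" and N: "N = a + m + 1"
    using assms(1) by (auto simp: a_def b_def m_def N_def)
  interpret prob_space "sample_space n S" by (rule prob_space_sample_space[OF assms(3)])
  have e [measurable]: "e \<in> borel_measurable (sample_space n S)"
    unfolding e_def[abs_def] by (rule nn_integral_prediction_loss(1)[OF assms(3,1,2)])
  have [measurable]: "X \<in> borel_measurable (sample_space n S)"
    unfolding X_def[abs_def] by measurable
  have X1: "(\<integral>\<^sup>+\<omega>. ennreal (X \<omega>) \<partial>sample_space n S) = ennreal (1 + c)"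
    unfolding X_def e_def c_def a_def m_def N_def by (rule nn_integral_prediction_loss(2)[OF assms(3,1,2)])
  have X2: "(\<integral>\<^sup>+\<omega>. ennreal ((X \<omega>)\<^sup>2) \<partial>sample_space n S) = ennreal s"
    unfolding X_def e_def s_def a_def b_def m_def N_def by (rule nn_integral_prediction_loss(3)[OF assms(3,1,2)])
  \<comment> \<open>The origin of the polynomial in the bound: it is 3 (N - 1) (N - 3) a - m^2 b,
    that is, \<open>s - c\<^sup>2\<close> cleared of its denominator
    \<open>a\<^sup>2 * b\<close>.\<close>
  have s_c: "s - c\<^sup>2 = P / b / a\<^sup>2"
  proof -
    have nz: "a \<noteq> 0" "b \<noteq> 0" using pos by auto
    have P: "P = 3 * (a\<^sup>2 * b + 2 * m * a * b + m * (m + 2) * a) - m\<^sup>2 * b"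
      unfolding P_def N ab by (simp add: power2_eq_square power3_eq_cube algebra_simps)
    show ?thesis
      unfolding P s_def c_def using nz by (simp add: field_simps power2_eq_square)
  qed
  have "c\<^sup>2 < s"
  proof -
    \<comment> \<open>Since \<open>b = a - 2\<close> is smaller than \<open>a\<close>, already the
      last summand of \<open>s\<close> dominates \<open>c\<^sup>2\<close>; the deviation used in
      Chebyshev's inequality is thus positive.\<close>
    have "c\<^sup>2 \<le> m * (m + 2) / (a * b)"
      unfolding c_def power2_eq_square times_divide_times_eq
      using pos ab by (intro frac_le mult_left_mono mult_mono) auto
    moreover have "0 \<le> m / a" using pos by simp
    moreover have "0 \<le> c\<^sup>2" by simp
    moreover have "t < 3 * (1 + 2 * x + y)" if "t \<le> y" "0 \<le> x" "0 \<le> t" for t x y :: real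
      using that by simp
    ultimately show ?thesis unfolding s_def by blast
  qed
  then have "1 - delta \<le> prob {\<omega> \<in> space (sample_space n S). X \<omega> \<le> c + sqrt ((s - c\<^sup>2) / delta)}"
    using pos assms(4) X1 X2 by (intro prob_le_second_moment_about[where \<mu>="1 + c"]) (auto simp: X_def c_def)
  moreover have "X \<omega> \<le> c + sqrt ((s - c\<^sup>2) / delta) \<longleftrightarrow>
      (e \<omega>)\<^sup>2 \<le> sigma\<^sup>2 / (N - m - 1) * (m + 1 / sqrt delta * sqrt (P / (N - m - 3)))" for \<omega>
  proof -
    \<comment> \<open>Taking \<open>a\<^sup>2\<close> out of the root gives the deviation the same
      denominator \<open>a\<close> as the centre \<open>c\<close>, which becomes the common
      prefactor after multiplication by \<open>sigma\<^sup>2\<close>.\<close>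
    have "sqrt ((s - c\<^sup>2) / delta) = 1 / sqrt delta * sqrt (P / b) / a"
      using pos unfolding s_c by (simp add: real_sqrt_divide real_sqrt_mult)
    then have "c + sqrt ((s - c\<^sup>2) / delta) = (m + 1 / sqrt delta * sqrt (P / b)) / a"
      by (simp add: c_def add_divide_distrib)
    moreover have "X \<omega> \<le> t / a \<longleftrightarrow> (e \<omega>)\<^sup>2 \<le> sigma\<^sup>2 / a * t" for t
      using assms(2) pos by (simp add: X_def power_divide field_simps)
    ultimately show ?thesis by (simp only: a_def[symmetric] b_def[symmetric])
  qed
  ultimately show ?thesis
    by (simp add: e_def Let_def m_def N_def P_def)
qed

end
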